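(* Let $P$ be an irreducible, positive recurrent stochastic matrix on $\mathbb{F}=\mathbb{Z}_+\times\mathbb{D}$ (not necessarily block monotone). Suppose that (i) $P\prec_d\widetilde P$ for some irreducible stochastic matrix $\widetilde P\in\mathsf{BM}_d$ on $\mathbb{F}$; and (ii) there exist a constant $b\in(0,\infty)$, a column vector $v=(v(k,i))_{(k,i)\in\mathbb{F}}\in\mathsf{BI}_d$ with $v\ge e$, and a nondecreasing differentiable concave function $\phi:[1,\infty)\to(0,\infty)$ with $\lim_{t\to\infty}\phi'(t)=0$ such that, for some $M\in\mathbb{N}$ and $K\in\mathbb{Z}_+$, $$\widetilde P^M v\le v-\phi\circ v+b\,1_K,\qquad(\mathrm{a})$$ $$\widetilde P^M(K;0)\,e>0\ \text{(entrywise)}.\qquad(\mathrm{b})$$ Let $B$ be a positive constant such that $B\,\widetilde P^M(K;0)e\ge b\,e$. Then, for all $m,n\in\mathbb{N}$, $$\|{}_{(n)}\pi_n-\pi\|\le\frac{8\{c_{\phi,B}(1)\}^{-1}}{r_\phi(c_{\phi,B}(m-1))}\{v(1,\varpi)+B\}+2mMb\sum_{i\in\mathbb{D}}\frac{1}{\phi(v(n,i))},$$ where $c_{\phi,B}(x)=\frac{\phi(1)}{\phi(B+1)}x$ for $x\ge0$. In addition, if $K=0$, then, for all $m,n\in\mathbb{N}$, $$\|{}_{(n)}\pi_n-\pi\|\le\frac{8}{r_\phi(m-1)}v(1,\varpi)+2mMb\sum_{i\in\mathbb{D}}\frac{1}{\phi(v(n,i))},$$ and this last bound holds without assuming (b)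.
   Context: Notation: $\mathbb{Z}_+=\{0,1,2,\dots\}$, $\mathbb{N}=\{1,2,\dots\}$, $d\in\mathbb{N}$, $\mathbb{D}=\{1,\dots,d\}$, $\mathbb{F}=\mathbb{Z}_+\times\mathbb{D}$. A stochastic matrix $P=(p(k,i;\ell,j))_{(k,i),(\ell,j)\in\mathbb{F}}$ has $d\times d$ blocks $P(k;\ell)=(p(k,i;\ell,j))_{i,j\in\mathbb{D}}$; $\widetilde P^M(k;\ell)$ denotes the $(k,\ell)$th $d\times d$ block of the $M$th power $\widetilde P^M$. All vector/matrix inequalities are entrywise; $e$ is a column vector of ones of appropriate size. Block monotonicity: a stochastic matrix $Q\in\mathsf{BM}_d$ means $\sum_{m=\ell}^\infty Q(k;m)\le\sum_{m=\ell}^\infty Q(k+1;m)$ for all $k,\ell\in\mathbb{Z}_+$. Block-wise dominance: $P\prec_d\widetilde P$ means $\sum_{m=\ell}^\infty P(k;m)\le\sum_{m=\ell}^\infty\widetilde P(k;m)$ for all $k,\ell\in\mathbb{Z}_+$. A column vector $f=(f(k,i))$ is block increasing ($f\in\mathsf{BI}_d$) if $f(k,i)\le f(k+1,i)$ for all $(k,i)\in\mathbb{F}$. $\varpi=(\varpi(i))_{i\in\mathbb{D}}$ is the unique stationary probability vector of the irreducible $d\times d$ stochastic matrix $\sum_{m=0}^\infty\widetilde P(k;m)$, which does not depend on $k$ and equals $\sum_{m=0}^\infty P(k;m)$ (by $\widetilde P\in\mathsf{BM}_d$ and $P\prec_d\widetilde P$); equivalently $\varpi(i)=\sum_{k=0}^\infty\pi(k,i)$.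 $\pi$ is the unique stationary probability vector of $P$. For $n\in\mathbb{N}$, the LC-block-augmented truncation ${}_{(n)}P_n$ of $P$ is the stochastic matrix on $\mathbb{F}$ with entries ${}_{(n)}p_n(k,i;\ell,j)=p(k,i;\ell,j)$ if $0\le\ell\le n-1$; $=\sum_{m=n}^\infty p(k,i;m,j)$ if $\ell=n$; $=0$ if $\ell>n$. ${}_{(n)}\pi_n$ denotes a stationary probability vector of ${}_{(n)}P_n$ (at least one exists). $\|\mu-\eta\|=\sum_{(k,i)\in\mathbb{F}}|\mu(k,i)-\eta(k,i)|$. For a function $\varphi$ on $\mathbb{F}$, $\varphi(k,\varpi)=\sum_{i\in\mathbb{D}}\varpi(i)\varphi(k,i)$. The vector $1_K$ has entries $1$ at $(k,i)$ with $k\le K$, and $0$ elsewhere; $\phi\circ v$ has entries $\phi(v(k,i))$. $H_\phi(x)=\int_1^x \frac{dy}{\phi(y)}$ for $x\ge1$; it is increasing with $H_\phi(x)\to\infty$, so it has an inverse $H_\phi^{-1}:[0,\infty)\to[1,\infty)$; $r_\phi(x)=\phi(H_\phi^{-1}(x))$ for $x\ge0$. *)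

theory Defs
  imports "HOL-Analysis.Analysis"
begin

type_synonym 's mtx = "'s \<Rightarrow> 's \<Rightarrow> real"

text \<open>
  The state space is \<open>nat \<times> 'd\<close> (level, phase); the phase set \<open>{1,\<dots>,d}\<close>
  is an arbitrary finite (nonempty) type \<open>'d\<close>, with \<open>d = CARD('d)\<close>.
  Column and row vectors are functions into \<open>real\<close>.
\<close>

section \<open>Stochastic matrices on a countable or finite index type\<close>

definition prob_vec :: "('s \<Rightarrow> real) \<Rightarrow> bool" where
  "prob_vec \<mu> \<longleftrightarrow> (\<forall>x. 0 \<le> \<mu> x) \<and> (\<mu> has_sum 1) UNIV"

definition stochastic :: "'s mtx \<Rightarrow> bool" where
  "stochastic P \<longleftrightarrow> (\<forall>x. prob_vec (P x))"

definition mtx_mult :: "'s mtx \<Rightarrow> 's mtx \<Rightarrow> 's mtx" where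
  "mtx_mult A B x y = (\<Sum>\<^sub>\<infinity>z. A x z * B z y)"

primrec mtx_pow :: "'s mtx \<Rightarrow> nat \<Rightarrow> 's mtx" where
  "mtx_pow P 0 = (\<lambda>x y. if x = y then 1 else 0)"
| "mtx_pow P (Suc n) = mtx_mult P (mtx_pow P n)"

definition irreducible_mtx :: "'s mtx \<Rightarrow> bool" where
  "irreducible_mtx P \<longleftrightarrow> (\<forall>x y. \<exists>n. 0 < mtx_pow P n x y)"

text \<open>
  \<open>first_passage P n x y\<close> is the probability that the chain started in \<open>x\<close> visits \<open>y\<close>
  at time \<open>n + 1\<close> and at none of the times \<open>1, \<dots>, n\<close>.
\<close>

primrec first_passage :: "'s mtx \<Rightarrow> nat \<Rightarrow> 's mtx" where
  "first_passage P 0 = P"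
| "first_passage P (Suc n) = (\<lambda>x y. \<Sum>\<^sub>\<infinity>z\<in>-{y}. P x z * first_passage P n z y)"

text \<open>Return to every state is almost sure, with finite mean return time.\<close>

definition positive_recurrent :: "'s mtx \<Rightarrow> bool" where
  "positive_recurrent P \<longleftrightarrow>
     (\<forall>x. (\<lambda>n. first_passage P n x x) sums 1 \<and>
          summable (\<lambda>n. real (n + 1) * first_passage P n x x))"

definition stationary :: "'s mtx \<Rightarrow> ('s \<Rightarrow> real) \<Rightarrow> bool" where
  "stationary P \<mu> \<longleftrightarrow> prob_vec \<mu> \<and> (\<forall>y. ((\<lambda>x. \<mu> x * P x y) has_sum \<mu> y) UNIV)"

definition l1_dist :: "('s \<Rightarrow> real) \<Rightarrow> ('s \<Rightarrow> real) \<Rightarrow> real" where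
  "l1_dist \<mu> \<eta> = (\<Sum>\<^sub>\<infinity>x. \<bar>\<mu> x - \<eta> x\<bar>)"

text \<open>
  \<open>A v \<le> w\<close> entrywise, for nonnegative \<open>A\<close> and \<open>v\<close>. The summability conjunct says that
  \<open>A v\<close> is finite, as is implicit in the inequality; \<open>infsum\<close> alone would be \<open>0\<close> on a
  divergent row.
\<close>

definition mtx_vec_le :: "'s mtx \<Rightarrow> ('s \<Rightarrow> real) \<Rightarrow> ('s \<Rightarrow> real) \<Rightarrow> bool" where
  "mtx_vec_le A v w \<longleftrightarrow>
     (\<forall>x. (\<lambda>y. A x y * v y) summable_on UNIV \<and> (\<Sum>\<^sub>\<infinity>y. A x y * v y) \<le> w x)"

section \<open>Block structure\<close>

text \<open>Entry \<open>(i, j)\<close> of the block sum \<open>\<Sum>m\<ge>l. P(k;m)\<close>.\<close>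

definition block_tail :: "(nat \<times> 'd) mtx \<Rightarrow> nat \<Rightarrow> nat \<Rightarrow> 'd mtx" where
  "block_tail P k l i j = (\<Sum>\<^sub>\<infinity>m\<in>{l..}. P (k, i) (m, j))"

definition block_monotone :: "(nat \<times> 'd) mtx \<Rightarrow> bool" where
  "block_monotone Q \<longleftrightarrow> stochastic Q \<and>
     (\<forall>k l i j. block_tail Q k l i j \<le> block_tail Q (k + 1) l i j)"

definition block_dominated :: "(nat \<times> 'd) mtx \<Rightarrow> (nat \<times> 'd) mtx \<Rightarrow> bool" where
  "block_dominated P Q \<longleftrightarrow> (\<forall>k l i j. block_tail P k l i j \<le> block_tail Q k l i j)"

definition block_increasing :: "(nat \<times> 'd \<Rightarrow> real) \<Rightarrow> bool" where
  "block_increasing f \<longleftrightarrow> (\<forall>k i. f (k, i) \<le> f (k + 1, i))"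

text \<open>
  Transition matrix of the phases out of level \<open>k\<close>. For block monotone \<open>P\<close> it does not
  depend on \<open>k\<close>.
\<close>

definition phase_mtx :: "(nat \<times> 'd) mtx \<Rightarrow> nat \<Rightarrow> 'd mtx" where
  "phase_mtx P k = block_tail P k 0"

definition lc_trunc :: "(nat \<times> 'd) mtx \<Rightarrow> nat \<Rightarrow> (nat \<times> 'd) mtx" where
  "lc_trunc P n = (\<lambda>(k, i) (l, j).
     if l < n then P (k, i) (l, j)
     else if l = n then \<Sum>\<^sub>\<infinity>m\<in>{n..}. P (k, i) (m, j)
     else 0)"

definition level_avg :: "(nat \<times> 'd::finite \<Rightarrow> real) \<Rightarrow> nat \<Rightarrow> ('d \<Rightarrow> real) \<Rightarrow> real" where
  "level_avg f k \<omega> = (\<Sum>i\<in>UNIV. \<omega> i * f (k, i))"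

definition one_upto :: "nat \<Rightarrow> nat \<times> 'd \<Rightarrow> real" where
  "one_upto K = (\<lambda>(k, i). if k \<le> K then 1 else 0)"

section \<open>Rate functions\<close>

text \<open>Only the values of \<open>\<phi>\<close> on \<open>{1..}\<close> matter.\<close>

definition H_fn :: "(real \<Rightarrow> real) \<Rightarrow> real \<Rightarrow> real" where
  "H_fn \<phi> x = integral {1..x} (\<lambda>y. 1 / \<phi> y)"

definition H_inv :: "(real \<Rightarrow> real) \<Rightarrow> real \<Rightarrow> real" where
  "H_inv \<phi> = the_inv_into {1..} (H_fn \<phi>)"

definition r_fn :: "(real \<Rightarrow> real) \<Rightarrow> real \<Rightarrow> real" where
  "r_fn \<phi> x = \<phi> (H_inv \<phi> x)"

definition c_fn :: "(real \<Rightarrow> real) \<Rightarrow> real \<Rightarrow> real \<Rightarrow> real" where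
  "c_fn \<phi> B x = \<phi> 1 / \<phi> (B + 1) * x"

end

theory Submission
  imports Defs
begin

text \<open>
  Let \<open>T\<close> be the \<open>M\<close>-th power of the block monotone matrix. Two chains that are dominated by \<open>T\<close> and
  start with the same phases can be run below a common copy of \<open>T\<close>; since the phases always agree,
  they coincide from the time at which that copy hits level \<open>0\<close>. Hence two starting distributions
  are forgotten at the rate at which \<open>T\<close> reaches level \<open>0\<close>. Started from an invariant vector of a
  dominated chain, \<open>T\<close> avoids level \<open>0\<close> for \<open>m\<close> steps with probability at most the expected excess
  over \<open>m\<close> of the length of an excursion from level \<open>0\<close>, which the drift condition bounds by
  \<open>v(1, \<omega>) / r(m)\<close>, through the functions \<open>G (H (v x) + j) - G j\<close> where \<open>G\<close> is the inverse
  of \<open>H\<close>. For \<open>K > 0\<close> the drift condition is first moved to level \<open>0\<close> by adding \<open>B\<close> to \<open>v\<close> off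
  level \<open>0\<close>. The stationary vector of the truncation is compared with \<open>m M\<close> steps of \<open>P\<close>; each step
  costs the stationary mass of level \<open>n\<close> under the truncated chain, on whose
  levels \<open>v\<close> is bounded, so that the drift inequality can be integrated.
\<close>

section \<open>Expectations over countable state spaces\<close>

text \<open>Row vector times column vector, with values in \<open>ennreal\<close>: all sums exist
  and may be exchanged, so finiteness is an issue mainly where terms are cancelled.\<close>

definition expect :: "('s \<Rightarrow> ennreal) \<Rightarrow> ('s \<Rightarrow> ennreal) \<Rightarrow> ennreal" where
  "expect \<mu> f = (\<integral>\<^sup>+x. \<mu> x * f x \<partial>count_space UNIV)"

definition app :: "'s mtx \<Rightarrow> ('s \<Rightarrow> ennreal) \<Rightarrow> 's \<Rightarrow> ennreal" where
  "app P f x = expect (\<lambda>y. ennreal (P x y)) f"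

definition push :: "('s \<Rightarrow> ennreal) \<Rightarrow> 's mtx \<Rightarrow> 's \<Rightarrow> ennreal" where
  "push \<mu> P y = expect \<mu> (\<lambda>x. ennreal (P x y))"

lemma expect_mono: "(\<And>x. f x \<le> g x) \<Longrightarrow> expect \<mu> f \<le> expect \<mu> g"
  unfolding expect_def by (intro nn_integral_mono mult_left_mono) auto

lemma expect_add: "expect \<mu> (\<lambda>x. f x + g x) = expect \<mu> f + expect \<mu> g"
  unfolding expect_def by (simp add: distrib_left nn_integral_add)

lemma expect_add_left: "expect (\<lambda>x. \<mu> x + \<nu> x) f = expect \<mu> f + expect \<nu> f"
  unfolding expect_def by (simp add: distrib_right nn_integral_add)

lemma expect_cmult: "expect \<mu> (\<lambda>x. c * f x) = c * expect \<mu> f"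
  unfolding expect_def by (simp add: mult.left_commute nn_integral_cmult)

lemma expect_sum: "expect \<mu> (\<lambda>x. \<Sum>i\<in>I. f i x) = (\<Sum>i\<in>I. expect \<mu> (f i))"
  unfolding expect_def by (simp add: sum_distrib_left nn_integral_sum)

lemma nn_integral_delta:
  "(\<integral>\<^sup>+x. f x * (if x = a then 1 else 0) \<partial>count_space UNIV) = (f a :: ennreal)"
proof -
  have "(\<integral>\<^sup>+x. f x * (if x = a then 1 else 0) \<partial>count_space UNIV)
      = (\<Sum>x\<in>{a}. f x * (if x = a then 1 else 0))"
    by (rule nn_integral_count_space') auto
  then show ?thesis by simp
qed

lemma expect_delta: "expect \<mu> (\<lambda>x. if x = a then 1 else 0) = \<mu> a"
  unfolding expect_def by (rule nn_integral_delta)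

lemma expect_point: "expect (\<lambda>x. if x = a then 1 else 0) f = f a"
  unfolding expect_def using nn_integral_delta[of f a] by (simp add: mult.commute)

text \<open>Associativity of row vector, matrix and column vector: two nonnegative sums are
  exchanged (Tonelli), for which the state space is taken countable.\<close>

lemma expect_push:
  fixes \<mu> :: "'s::countable \<Rightarrow> ennreal"
  shows "expect (push \<mu> P) f = expect \<mu> (app P f)"
proof -
  have "expect (push \<mu> P) f
      = (\<integral>\<^sup>+y. \<integral>\<^sup>+x. \<mu> x * ennreal (P x y) * f y \<partial>count_space UNIV \<partial>count_space UNIV)"
    unfolding expect_def push_def by (simp add: nn_integral_multc)
  also have "\<dots> = (\<integral>\<^sup>+x. \<integral>\<^sup>+y. \<mu> x * ennreal (P x y) * f y \<partial>count_space UNIV \<partial>count_space UNIV)"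
    by (rule nn_integral_count_space_nn_integral) auto
  also have "\<dots> = expect \<mu> (app P f)"
    unfolding expect_def app_def by (simp add: nn_integral_cmult mult.assoc)
  finally show ?thesis .
qed

lemma app_mono: "(\<And>x. f x \<le> g x) \<Longrightarrow> app P f x \<le> app P g x"
  unfolding app_def by (rule expect_mono)

lemma app_add: "app P (\<lambda>x. f x + g x) x = app P f x + app P g x"
  unfolding app_def by (rule expect_add)

lemma app_cmult: "app P (\<lambda>x. c * f x) x = c * app P f x"
  unfolding app_def by (rule expect_cmult)

lemma app_sum: "app P (\<lambda>x. \<Sum>i\<in>I. f i x) x = (\<Sum>i\<in>I. app P (f i) x)"
  unfolding app_def by (rule expect_sum)

lemma app_delta: "app P (\<lambda>x. if x = a then 1 else 0) x = ennreal (P x a)"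
  unfolding app_def by (rule expect_delta)

section \<open>Real sums as integrals over the counting measure\<close>

lemma has_sum_nn_integral:
  assumes "\<And>x. 0 \<le> f x" and "(f has_sum s) UNIV"
  shows "(\<integral>\<^sup>+x. ennreal (f x) \<partial>count_space UNIV) = ennreal s"
proof -
  have "Infinite_Sum.abs_summable_on f UNIV"
    using assms by (simp add: has_sum_imp_summable)
  then have a: "Infinite_Set_Sum.abs_summable_on f UNIV" by (simp only: abs_summable_equivalent)
  have "(\<integral>\<^sup>+x. ennreal (f x) \<partial>count_space UNIV) = ennreal (infsetsum f UNIV)"
    by (rule nn_integral_conv_infsetsum[OF a]) (rule assms(1))
  also have "\<dots> = ennreal s"
    using infsetsum_infsum[OF a] infsumI[OF assms(2)] by simp
  finally show ?thesis .
qed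

lemma nn_integral_has_sum:
  assumes nn: "\<And>x. 0 \<le> f x" and eq: "(\<integral>\<^sup>+x. ennreal (f x) \<partial>count_space UNIV) = ennreal s" and "0 \<le> s"
  shows "(f has_sum s) UNIV"
proof -
  have "Infinite_Set_Sum.abs_summable_on f UNIV"
    unfolding abs_summable_on_def
    by (rule integrableI_bounded) (use assms in auto)
  then have s: "Infinite_Sum.abs_summable_on f UNIV" by (simp only: abs_summable_equivalent)
  then have "(f has_sum infsum f UNIV) UNIV" using nn by auto
  moreover from has_sum_nn_integral[OF nn this] have "infsum f UNIV = s"
    using eq \<open>0 \<le> s\<close> nn by (simp add: infsum_nonneg)
  ultimately show ?thesis by simp
qed

lemma infsum_nn_integral:
  assumes "\<And>x. 0 \<le> f x" and "f summable_on UNIV"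
  shows "ennreal (infsum f UNIV) = (\<integral>\<^sup>+x. ennreal (f x) \<partial>count_space UNIV)"
  using has_sum_nn_integral[OF assms(1) has_sum_infsum[OF assms(2)]] by simp

section \<open>Stochastic matrices and their powers as operators\<close>

lemma stochastic_nonneg: "stochastic P \<Longrightarrow> 0 \<le> P x y"
  by (simp add: stochastic_def prob_vec_def)

lemma prob_vec_total: "prob_vec \<mu> \<Longrightarrow> expect (\<lambda>x. ennreal (\<mu> x)) (\<lambda>x. 1) = 1"
  unfolding prob_vec_def expect_def using has_sum_nn_integral[of \<mu> 1] by simp

lemma stochastic_app_one: "stochastic P \<Longrightarrow> app P (\<lambda>x. 1) x = 1"
  unfolding app_def stochastic_def by (simp add: prob_vec_total)

lemma app_le_one: "stochastic P \<Longrightarrow> (\<And>x. f x \<le> 1) \<Longrightarrow> app P f x \<le> 1"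
  using app_mono[of f "\<lambda>x. 1" P x] by (simp add: stochastic_app_one)

lemma stochastic_le_one:
  assumes "stochastic P" shows "P x y \<le> 1"
proof -
  have "ennreal (P x y) \<le> ennreal 1"
    using app_le_one[OF assms, of "\<lambda>z. if z = y then 1 else 0"]
    by (simp add: app_delta)
  then show ?thesis by (simp add: ennreal_le_iff del: ennreal_1)
qed

lemma stochasticI:
  assumes "\<And>x y. 0 \<le> P x y" "\<And>x. app P (\<lambda>x. 1) x = 1"
  shows "stochastic P"
  unfolding stochastic_def prob_vec_def
  using assms nn_integral_has_sum[of "P x" 1 for x] by (simp add: app_def expect_def)

text \<open>Entries of \<open>Q\<close> are at most 1, so the summable row of \<open>P\<close>
  dominates the series and \<open>infsum\<close> is a genuine sum rather than its default value
  0.\<close>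

lemma mtx_mult_app:
  assumes P: "stochastic P" and Q: "stochastic Q"
  shows "ennreal (mtx_mult P Q x y) = app P (\<lambda>z. ennreal (Q z y)) x"
proof -
  have "P x summable_on UNIV"
    using P unfolding stochastic_def prob_vec_def by (auto intro: has_sum_imp_summable)
  then have s: "(\<lambda>z. P x z * Q z y) summable_on UNIV"
    by (rule summable_on_comparison_test)
      (use stochastic_nonneg[OF P] stochastic_nonneg[OF Q] stochastic_le_one[OF Q]
       in \<open>auto intro: mult_left_le\<close>)
  show ?thesis
    unfolding mtx_mult_def app_def expect_def
    using infsum_nn_integral[OF _ s] stochastic_nonneg[OF P] stochastic_nonneg[OF Q]
    by (simp add: ennreal_mult)
qed

lemma app_mtx_mult:
  fixes P :: "'s::countable mtx"
  assumes P: "stochastic P" and Q: "stochastic Q"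
  shows "app (mtx_mult P Q) f x = app P (app Q f) x"
  unfolding app_def[of "mtx_mult P Q"] app_def[of P]
  by (subst expect_push[symmetric]) (simp add: push_def[abs_def] mtx_mult_app[OF assms] app_def)

lemma stochastic_mtx_mult:
  fixes P :: "'s::countable mtx"
  assumes P: "stochastic P" and Q: "stochastic Q"
  shows "stochastic (mtx_mult P Q)"
proof (rule stochasticI)
  show "0 \<le> mtx_mult P Q x y" for x y
    unfolding mtx_mult_def using stochastic_nonneg[OF P] stochastic_nonneg[OF Q]
    by (intro infsum_nonneg) auto
  have "app Q (\<lambda>x. 1) = (\<lambda>x. 1)" by (rule ext) (simp add: stochastic_app_one[OF Q])
  then show "app (mtx_mult P Q) (\<lambda>x. 1) x = 1" for x
    by (simp add: app_mtx_mult[OF P Q] stochastic_app_one[OF P])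
qed

lemma app_mtx_pow_0: "app (mtx_pow P 0) f x = f x"
proof -
  have "(\<lambda>y. ennreal (if x = y then 1 else 0)) = (\<lambda>y. if y = x then 1 else 0)"
    by auto
  then show ?thesis by (simp add: app_def expect_point)
qed

lemma stochastic_mtx_pow:
  fixes P :: "'s::countable mtx"
  assumes "stochastic P" shows "stochastic (mtx_pow P n)"
proof (induction n)
  case 0
  show ?case
    by (rule stochasticI) (simp_all only: app_mtx_pow_0, simp)
qed (simp add: stochastic_mtx_mult assms)

lemma app_mtx_pow:
  fixes P :: "'s::countable mtx"
  assumes "stochastic P" shows "app (mtx_pow P n) f = (app P ^^ n) f"
proof (induction n)
  case 0
  then show ?case by (simp add: fun_eq_iff app_mtx_pow_0 del: mtx_pow.simps)
next
  case (Suc n)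
  have "app (mtx_pow P (Suc n)) f = app P (app (mtx_pow P n) f)"
    by (rule ext) (simp add: app_mtx_mult assms stochastic_mtx_pow)
  then show ?case by (simp add: Suc)
qed

lemma expect_stationary:
  fixes P :: "'s::countable mtx"
  assumes "stochastic P" "stationary P \<mu>"
  shows "expect (\<lambda>x. ennreal (\<mu> x)) (app P f) = expect (\<lambda>x. ennreal (\<mu> x)) f"
proof -
  have nn: "0 \<le> \<mu> x" for x using assms by (simp add: stationary_def prob_vec_def)
  have "push (\<lambda>x. ennreal (\<mu> x)) P = (\<lambda>y. ennreal (\<mu> y))"
    unfolding fun_eq_iff push_def expect_def
    using has_sum_nn_integral[of "\<lambda>x. \<mu> x * P x y" "\<mu> y" for y] assms nn stochastic_nonneg[OF assms(1)]
    by (simp add: stationary_def ennreal_mult)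
  then show ?thesis using expect_push[of "\<lambda>x. ennreal (\<mu> x)" P f] by simp
qed

lemma expect_stationary_pow:
  fixes P :: "'s::countable mtx"
  assumes "stochastic P" "stationary P \<mu>"
  shows "expect (\<lambda>x. ennreal (\<mu> x)) ((app P ^^ n) f) = expect (\<lambda>x. ennreal (\<mu> x)) f"
  by (induction n) (simp_all add: expect_stationary[OF assms])

section \<open>Block dominance and the coupling inequality\<close>

definition binc :: "(nat \<times> 'd \<Rightarrow> ennreal) \<Rightarrow> bool" where
  "binc f \<longleftrightarrow> (\<forall>k i. f (k, i) \<le> f (Suc k, i))"

lemma binc_le: "binc f \<Longrightarrow> k \<le> l \<Longrightarrow> f (k, i) \<le> f (l, i)"
  by (rule lift_Suc_mono_le[of "\<lambda>k. f (k, i)"]) (simp_all add: binc_def)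

lemma ennreal_add_right_cancel_le: "a + c \<le> b + c \<Longrightarrow> c < top \<Longrightarrow> a \<le> (b::ennreal)"
  by (auto simp: add.commute[of _ c] ennreal_add_left_cancel_le)

text \<open>These indicators generate the block increasing functions, and \<open>app\<close> sends
  them to the entries of \<open>block_tail\<close>; through them the tail conditions become
  statements about operators.\<close>

definition upper :: "nat \<Rightarrow> 'd \<Rightarrow> nat \<times> 'd \<Rightarrow> ennreal" where
  "upper l j = (\<lambda>(k, i). if l \<le> k \<and> i = j then 1 else 0)"

lemma binc_upper: "binc (upper l j)"
  by (auto simp: binc_def upper_def)

lemma nn_integral_levels:
  "(\<integral>\<^sup>+x. f x \<partial>count_space UNIV) = (\<Sum>j\<in>UNIV. \<integral>\<^sup>+k. f (k, j) \<partial>count_space UNIV)"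
  for f :: "nat \<times> 'd::finite \<Rightarrow> ennreal"
  by (subst nn_integral_snd_count_space[symmetric]) (simp add: nn_integral_count_space_finite)

lemma expect_upper:
  fixes a :: "nat \<times> 'd::finite \<Rightarrow> ennreal"
  shows "expect a (upper l j) = (\<integral>\<^sup>+k. (if l \<le> k then a (k, j) else 0) \<partial>count_space UNIV)"
proof -
  have "expect a (upper l j) = (\<Sum>i\<in>UNIV. if i = j then
      (\<integral>\<^sup>+k. (if l \<le> k then a (k, j) else 0) \<partial>count_space UNIV) else 0)"
    unfolding expect_def nn_integral_levels
    by (intro sum.cong refl) (auto simp: upper_def intro!: nn_integral_cong)
  then show ?thesis by simp
qed

text \<open>Summation by parts: a block increasing function is a nonnegative combination of the
  indicators \<open>upper l j\<close>.\<close>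

lemma expect_binc_upper:
  fixes f :: "nat \<times> 'd::finite \<Rightarrow> ennreal"
  assumes "binc f"
  shows "\<exists>D. \<forall>a. expect a f = (\<Sum>j\<in>UNIV. \<integral>\<^sup>+l. D l j * expect a (upper l j) \<partial>count_space UNIV)"
proof -
  \<comment> \<open>Increments of \<open>f\<close> along the levels, starting with
    \<open>f (0, j)\<close>; monotonicity makes them add back to \<open>f\<close> even where
    \<open>f\<close> is infinite.\<close>
  define D where "D l j = (case l of 0 \<Rightarrow> f (0, j) | Suc n \<Rightarrow> f (Suc n, j) - f (n, j))" for l j
  have f: "f (k, j) = (\<Sum>l\<le>k. D l j)" for k j
  proof (induction k)
    case (Suc k)
    have "f (k, j) + (f (Suc k, j) - f (k, j)) = f (Suc k, j)"
      using assms by (intro add_diff_inverse_ennreal) (simp add: binc_def)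
    moreover have "(\<Sum>l\<le>Suc k. D l j) = f (k, j) + D (Suc k) j"
      unfolding sum.atMost_Suc Suc[symmetric] ..
    ultimately show ?case by (simp only: D_def nat.case)
  qed (simp add: D_def)
  have f': "f (k, j) = (\<integral>\<^sup>+l. D l j * (if l \<le> k then 1 else 0) \<partial>count_space UNIV)" for k j
  proof -
    have "(\<integral>\<^sup>+l. D l j * (if l \<le> k then 1 else 0) \<partial>count_space UNIV)
        = (\<Sum>l\<in>{..k}. D l j * (if l \<le> k then 1 else 0))"
      by (rule nn_integral_count_space') auto
    then show ?thesis using f by simp
  qed
  have "expect a f = (\<Sum>j\<in>UNIV. \<integral>\<^sup>+l. D l j * expect a (upper l j) \<partial>count_space UNIV)" for a
  proof -
    have "expect a f = (\<Sum>j\<in>UNIV. \<integral>\<^sup>+k. \<integral>\<^sup>+l. D l j * (if l \<le> k then a (k, j) else 0)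
        \<partial>count_space UNIV \<partial>count_space UNIV)"
      unfolding expect_def nn_integral_levels f'
      by (intro sum.cong nn_integral_cong refl, subst nn_integral_cmult[symmetric])
        (auto intro!: nn_integral_cong simp: mult.commute)
    also have "\<dots> = (\<Sum>j\<in>UNIV. \<integral>\<^sup>+l. \<integral>\<^sup>+k. D l j * (if l \<le> k then a (k, j) else 0)
        \<partial>count_space UNIV \<partial>count_space UNIV)"
      by (intro sum.cong refl nn_integral_count_space_nn_integral) auto
    also have "\<dots> = (\<Sum>j\<in>UNIV. \<integral>\<^sup>+l. D l j * expect a (upper l j) \<partial>count_space UNIV)"
      by (simp add: expect_upper nn_integral_cmult)
    finally show ?thesis .
  qed
  then show ?thesis by blast
qed

text \<open>The weights \<open>D\<close> are nonnegative and do not depend on the measure, so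
  comparison on the generators is enough.\<close>

lemma expect_binc_mono:
  fixes a b :: "nat \<times> 'd::finite \<Rightarrow> ennreal"
  assumes "binc f" and "\<And>l j. expect a (upper l j) \<le> expect b (upper l j)"
  shows "expect a f \<le> expect b f"
proof -
  obtain D where D: "\<And>a. expect a f = (\<Sum>j\<in>UNIV. \<integral>\<^sup>+l. D l j * expect a (upper l j) \<partial>count_space UNIV)"
    using expect_binc_upper[OF assms(1)] by blast
  show ?thesis
    unfolding D using assms(2) by (intro sum_mono nn_integral_mono mult_left_mono) auto
qed

lemma app_upper:
  fixes P :: "(nat \<times> 'd::finite) mtx"
  assumes "stochastic P"
  shows "app P (upper l j) (k, i) = ennreal (block_tail P k l i j)"
proof -
  have s: "(\<lambda>m. P (k, i) (m, j)) summable_on A" for A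
  proof -
    have "P (k, i) summable_on UNIV"
      using assms unfolding stochastic_def prob_vec_def by (auto intro: has_sum_imp_summable)
    then have "P (k, i) summable_on ((\<lambda>m. (m, j)) ` A)"
      by (rule summable_on_subset_banach) auto
    then show ?thesis
      by (subst (asm) summable_on_reindex) (auto simp: inj_on_def o_def)
  qed
  have "block_tail P k l i j = (\<Sum>\<^sub>\<infinity>m. if l \<le> m then P (k, i) (m, j) else 0)"
    unfolding block_tail_def by (rule infsum_cong_neutral) auto
  moreover have "(\<lambda>m. if l \<le> m then P (k, i) (m, j) else 0) summable_on UNIV"
    using s[of UNIV] by (rule summable_on_comparison_test) (simp_all add: stochastic_nonneg[OF assms])
  ultimately have "ennreal (block_tail P k l i j)
      = (\<integral>\<^sup>+m. ennreal (if l \<le> m then P (k, i) (m, j) else 0) \<partial>count_space UNIV)"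
    using stochastic_nonneg[OF assms] infsum_nn_integral[of "\<lambda>m. if l \<le> m then P (k, i) (m, j) else 0"]
    by auto
  then show ?thesis
    unfolding app_def expect_upper by (auto intro!: nn_integral_cong)
qed

text \<open>Here \<open>f\<close> may be unbounded, which lets the relation be applied to the drift
  function \<open>v\<close> itself.\<close>

definition op_dom :: "(nat \<times> 'd) mtx \<Rightarrow> (nat \<times> 'd) mtx \<Rightarrow> bool" where
  "op_dom Q T \<longleftrightarrow> (\<forall>f x. binc f \<longrightarrow> app Q f x \<le> app T f x)"

definition op_mono :: "(nat \<times> 'd) mtx \<Rightarrow> bool" where
  "op_mono T \<longleftrightarrow> (\<forall>f. binc f \<longrightarrow> binc (app T f))"

lemma block_dominated_op_dom:
  fixes Q T :: "(nat \<times> 'd::finite) mtx"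
  assumes "stochastic Q" "stochastic T" "block_dominated Q T"
  shows "op_dom Q T"
  unfolding op_dom_def
proof (intro allI impI)
  fix f :: "nat \<times> 'd \<Rightarrow> ennreal" and x :: "nat \<times> 'd" assume f: "binc f"
  obtain k i where x: "x = (k, i)" by force
  have "app Q (upper l j) (k, i) \<le> app T (upper l j) (k, i)" for l and j :: 'd
    using assms by (simp add: app_upper block_dominated_def ennreal_leI)
  then show "app Q f x \<le> app T f x"
    unfolding x app_def by (rule expect_binc_mono[OF f])
qed

lemma block_monotone_op_mono:
  fixes T :: "(nat \<times> 'd::finite) mtx"
  assumes "block_monotone T"
  shows "op_mono T"
  unfolding op_mono_def binc_def
proof (intro allI impI)
  fix f :: "nat \<times> 'd \<Rightarrow> ennreal" and k i assume f: "\<forall>k i. f (k, i) \<le> f (Suc k, i)"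
  have "app T (upper l j) (k, i) \<le> app T (upper l j) (Suc k, i)" for l j
    using assms by (simp add: app_upper block_monotone_def ennreal_leI)
  then show "app T f (k, i) \<le> app T f (Suc k, i)"
    unfolding app_def using f by (intro expect_binc_mono[of f]) (simp_all add: binc_def)
qed

lemma op_mono_pow:
  fixes T :: "(nat \<times> 'd::finite) mtx"
  assumes "stochastic T" "op_mono T"
  shows "op_mono (mtx_pow T n)"
proof -
  have "binc f \<Longrightarrow> binc ((app T ^^ n) f)" for f
    by (induction n) (use assms in \<open>auto simp: op_mono_def\<close>)
  then show ?thesis by (simp add: op_mono_def app_mtx_pow assms)
qed

text \<open>One factor is exchanged at a time: monotonicity of \<open>T\<close> keeps the iterates
  of \<open>f\<close> under \<open>T\<close> block increasing, so that \<open>op_dom Q T\<close>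
  applies to them.\<close>

lemma op_dom_pow:
  fixes T :: "(nat \<times> 'd::finite) mtx"
  assumes "stochastic Q" "stochastic T" "op_mono T" "op_dom Q T"
  shows "op_dom (mtx_pow Q n) (mtx_pow T n)"
proof -
  have "(app Q ^^ n) f x \<le> (app T ^^ n) f x" if f: "binc f" for f x
  proof (induction n arbitrary: x)
    case (Suc n)
    have "app Q ((app Q ^^ n) f) x \<le> app Q ((app T ^^ n) f) x"
      by (rule app_mono) (rule Suc)
    also have "binc ((app T ^^ n) f)"
      using op_mono_pow[OF assms(2,3), of n] f by (simp add: op_mono_def app_mtx_pow assms)
    then have "app Q ((app T ^^ n) f) x \<le> app T ((app T ^^ n) f) x"
      using assms(4) unfolding op_dom_def by blast
    finally show ?case by simp
  qed simp
  then show ?thesis by (simp add: op_dom_def app_mtx_pow assms)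
qed

text \<open>Stochastic order along the levels between finite measures of equal mass. Restriction to
  \<open>f \<le> 1\<close> keeps all expectations finite, so common terms can be cancelled.\<close>

definition meas_dom :: "(nat \<times> 'd \<Rightarrow> ennreal) \<Rightarrow> (nat \<times> 'd \<Rightarrow> ennreal) \<Rightarrow> bool" where
  "meas_dom \<mu> \<nu> \<longleftrightarrow> expect \<nu> (\<lambda>x. 1) < \<infinity> \<and> expect \<mu> (\<lambda>x. 1) = expect \<nu> (\<lambda>x. 1) \<and>
     (\<forall>f. binc f \<and> (\<forall>x. f x \<le> 1) \<longrightarrow> expect \<mu> f \<le> expect \<nu> f)"

lemma meas_dom_le: "meas_dom \<mu> \<nu> \<Longrightarrow> binc f \<Longrightarrow> (\<And>x. f x \<le> 1) \<Longrightarrow> expect \<mu> f \<le> expect \<nu> f"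
  unfolding meas_dom_def by blast

lemma meas_dom_total: "meas_dom \<mu> \<nu> \<Longrightarrow> expect \<mu> (\<lambda>x. 1) = expect \<nu> (\<lambda>x. 1)"
  unfolding meas_dom_def by blast

lemma meas_dom_finite:
  assumes "meas_dom \<mu> \<nu>" "\<And>x. f x \<le> 1" shows "expect \<nu> f < top"
proof -
  have "expect \<nu> f \<le> expect \<nu> (\<lambda>x. 1)" by (rule expect_mono) (rule assms(2))
  also have "\<dots> < top" using assms(1) by (simp add: meas_dom_def)
  finally show ?thesis .
qed

lemma upper_le_one: "upper l j x \<le> 1"
  by (auto simp: upper_def split: prod.split)

text \<open>A function of the phase alone is block increasing and so is its complement, so the
  domination inequality holds in both directions. Measures in this order thus share their phase
  marginals.\<close>

lemma meas_dom_phase: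
  assumes d: "meas_dom \<mu> \<nu>" and g: "\<And>i. g i \<le> 1"
  shows "expect \<mu> (\<lambda>x. g (snd x)) = expect \<nu> (\<lambda>x. g (snd x))"
proof (rule antisym)
  let ?g = "\<lambda>x. g (snd x)" and ?h = "\<lambda>x. 1 - g (snd x)"
  have b: "binc ?g" "binc ?h" by (auto simp: binc_def)
  show "expect \<mu> ?g \<le> expect \<nu> ?g" by (rule meas_dom_le[OF d]) (use b g in auto)
  have 1: "expect \<mu> ?h \<le> expect \<nu> ?h" by (rule meas_dom_le[OF d]) (use b in \<open>auto simp: diff_le_self_ennreal\<close>)
  have s: "expect \<kappa> ?g + expect \<kappa> ?h = expect \<kappa> (\<lambda>x. 1)" for \<kappa>
    unfolding expect_add[symmetric] using g by (simp add: add_diff_inverse_ennreal)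
  have fin: "expect \<nu> ?h < \<infinity>"
    using meas_dom_finite[OF d, of ?h] by (simp add: diff_le_self_ennreal)
  have "expect \<nu> ?g + expect \<nu> ?h = expect \<mu> ?g + expect \<mu> ?h"
    unfolding s using meas_dom_total[OF d] by simp
  also have "\<dots> \<le> expect \<mu> ?g + expect \<nu> ?h" using 1 by (rule add_left_mono)
  finally show "expect \<nu> ?g \<le> expect \<mu> ?g"
    using fin by (auto intro: ennreal_add_right_cancel_le)
qed

text \<open>Two comparisons: \<open>Q\<close> with \<open>T\<close> on the function
  \<open>f\<close>, then \<open>\<mu>\<close> with \<open>\<nu>\<close> on \<open>app T f\<close>,
  which is block increasing because \<open>T\<close> is monotone.\<close>

lemma meas_dom_push:
  fixes Q T :: "(nat \<times> 'd::finite) mtx"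
  assumes d: "meas_dom \<mu> \<nu>" and Q: "stochastic Q" and T: "stochastic T"
    and "op_dom Q T" "op_mono T"
  shows "meas_dom (push \<mu> Q) (push \<nu> T)"
  unfolding meas_dom_def
proof (intro conjI allI impI)
  have 1: "app Q (\<lambda>x. 1) = (\<lambda>x. 1)" "app T (\<lambda>x. 1) = (\<lambda>x. 1)"
    using Q T by (auto simp: stochastic_app_one fun_eq_iff)
  show "expect (push \<nu> T) (\<lambda>x. 1) < \<infinity>" "expect (push \<mu> Q) (\<lambda>x. 1) = expect (push \<nu> T) (\<lambda>x. 1)"
    using d by (simp_all add: expect_push 1 meas_dom_def)
  fix f :: "nat \<times> 'd \<Rightarrow> ennreal" assume f: "binc f \<and> (\<forall>x. f x \<le> 1)"
  have "expect (push \<mu> Q) f \<le> expect \<mu> (app T f)"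
    unfolding expect_push using f assms(4) by (intro expect_mono) (metis op_dom_def)
  also have "\<dots> \<le> expect \<nu> (app T f)"
    by (rule meas_dom_le[OF d]) (use f assms(5) app_le_one[OF T, of f] in \<open>auto simp: op_mono_def\<close>)
  finally show "expect (push \<mu> Q) f \<le> expect (push \<nu> T) f" by (simp add: expect_push)
qed

section \<open>Level 0 and the coupling inequality\<close>

definition above0 :: "nat \<times> 'd \<Rightarrow> ennreal" where
  "above0 x = (if fst x = 0 then 0 else 1)"

lemma binc_above0: "binc above0"
  by (simp add: binc_def above0_def)

text \<open>\<open>avoid T m x\<close> is the probability that the chain \<open>T\<close> started in \<open>x\<close> stays off level \<open>0\<close>
  during the times \<open>0, \<dots>, m\<close>.\<close>

primrec avoid :: "(nat \<times> 'd) mtx \<Rightarrow> nat \<Rightarrow> nat \<times> 'd \<Rightarrow> ennreal" where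
  "avoid T 0 = above0"
| "avoid T (Suc m) = (\<lambda>x. above0 x * app T (avoid T m) x)"

lemma avoid_le_one: "stochastic T \<Longrightarrow> avoid T m x \<le> 1"
  by (induction m arbitrary: x) (auto simp: above0_def app_le_one)

lemma binc_avoid: "op_mono T \<Longrightarrow> binc (avoid T m)"
proof (induction m)
  case (Suc m)
  then have "binc (app T (avoid T m))" by (simp add: op_mono_def)
  then show ?case by (auto simp: binc_def above0_def)
qed (simp add: binc_above0)

lemma avoid_level0: "avoid T m (0, i) = 0"
  by (cases m) (auto simp: above0_def)

lemma avoid_antimono: "stochastic T \<Longrightarrow> avoid T (Suc m) x \<le> avoid T m x"
proof (induction m arbitrary: x)
  case 0
  then show ?case using app_le_one[OF 0, of above0 x] by (auto simp: above0_def)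
next
  case (Suc m)
  then show ?case
    unfolding avoid.simps(2)[of T "Suc m"] avoid.simps(2)[of T m] 
    by (intro mult_left_mono app_mono) (simp_all del: avoid.simps(2))
qed

text \<open>Phase marginals agree, and in each phase \<open>\<mu>\<close> has at most as much mass
  above level 0 as \<open>\<nu>\<close>; the difference sits on level 0.\<close>

lemma meas_dom_level0:
  fixes \<mu> \<nu> :: "nat \<times> 'd::finite \<Rightarrow> ennreal"
  assumes "meas_dom \<mu> \<nu>"
  shows "\<nu> (0, i) \<le> \<mu> (0, i)"
proof -
  have fin: "expect \<nu> (upper 1 i) < \<infinity>"
    using meas_dom_finite[OF assms upper_le_one] by simp
  have split: "\<kappa> (0, i) + expect \<kappa> (upper 1 i) = expect \<kappa> (\<lambda>x. if snd x = i then 1 else 0)" for \<kappa>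
  proof -
    have "(\<lambda>x. if snd x = i then 1 else 0)
        = (\<lambda>x. (if x = (0, i) then 1 else 0) + upper 1 i x)"
      by (auto simp: upper_def fun_eq_iff)
    then show ?thesis by (simp add: expect_add expect_delta)
  qed
  have "\<nu> (0, i) + expect \<nu> (upper 1 i) = \<mu> (0, i) + expect \<mu> (upper 1 i)"
    unfolding split using meas_dom_phase[OF assms, of "\<lambda>j. if j = i then 1 else 0"] by simp
  also have "\<dots> \<le> \<mu> (0, i) + expect \<nu> (upper 1 i)"
    by (intro add_left_mono meas_dom_le[OF assms] binc_upper upper_le_one)
  finally show ?thesis
    using fin by (auto intro: ennreal_add_right_cancel_le)
qed

definition on0 :: "(nat \<times> 'd \<Rightarrow> ennreal) \<Rightarrow> nat \<times> 'd \<Rightarrow> ennreal" where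
  "on0 \<nu> x = (if fst x = 0 then \<nu> x else 0)"

text \<open>The part of \<open>\<nu>\<close> on level 0 lies below \<open>\<mu>\<close>, so the
  truncated subtraction is exact. Removing it from both measures preserves their order, which is
  what lets \<open>coupling\<close> iterate.\<close>

lemma meas_dom_split:
  fixes \<mu> \<nu> :: "nat \<times> 'd::finite \<Rightarrow> ennreal"
  assumes d: "meas_dom \<mu> \<nu>"
  shows "expect \<mu> f = expect (on0 \<nu>) f + expect (\<lambda>x. \<mu> x - on0 \<nu> x) f"
    and "meas_dom (\<lambda>x. \<mu> x - on0 \<nu> x) (\<lambda>x. above0 x * \<nu> x)"
proof -
  have "\<mu> = (\<lambda>x. on0 \<nu> x + (\<mu> x - on0 \<nu> x))"
    using meas_dom_level0[OF d]
    by (auto simp: on0_def fun_eq_iff add_diff_inverse_ennreal)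
  then show \<mu>: "expect \<mu> f = expect (on0 \<nu>) f + expect (\<lambda>x. \<mu> x - on0 \<nu> x) f" for f
    using expect_add_left[of "on0 \<nu>" "\<lambda>x. \<mu> x - on0 \<nu> x" f] by simp
  have \<nu>: "expect \<nu> f = expect (on0 \<nu>) f + expect (\<lambda>x. above0 x * \<nu> x) f" for f
    unfolding expect_add_left[symmetric]
    by (intro arg_cong[of _ _ "\<lambda>h. expect h f"]) (auto simp: on0_def above0_def)
  have fin: "expect (on0 \<nu>) f < top" "expect (\<lambda>x. above0 x * \<nu> x) f < top" if "\<And>x. f x \<le> 1" for f
    using meas_dom_finite[OF d, of f] that unfolding \<nu>[of f] by auto
  show "meas_dom (\<lambda>x. \<mu> x - on0 \<nu> x) (\<lambda>x. above0 x * \<nu> x)"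
    unfolding meas_dom_def
  proof (intro conjI allI impI)
    show "expect (\<lambda>x. above0 x * \<nu> x) (\<lambda>x. 1) < \<infinity>" using fin by simp
    show "expect (\<lambda>x. \<mu> x - on0 \<nu> x) (\<lambda>x. 1) = expect (\<lambda>x. above0 x * \<nu> x) (\<lambda>x. 1)"
      using meas_dom_total[OF d] fin(1)[of "\<lambda>x. 1"] unfolding \<mu> \<nu>
      by (auto simp: ennreal_add_left_cancel)
    fix f :: "nat \<times> 'd \<Rightarrow> ennreal" assume f: "binc f \<and> (\<forall>x. f x \<le> 1)"
    then show "expect (\<lambda>x. \<mu> x - on0 \<nu> x) f \<le> expect (\<lambda>x. above0 x * \<nu> x) f"
      using meas_dom_le[OF d, of f] fin(1)[of f] unfolding \<mu>[of f] \<nu>[of f]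
      by (auto simp: ennreal_add_left_cancel_le)
  qed
qed

text \<open>The analytic form of the coupling argument: the mass of \<open>\<nu>\<close> on level \<open>0\<close> is common to all
  measures dominated by \<open>\<nu>\<close>, so it cancels at every step.\<close>

lemma coupling:
  fixes Q T :: "(nat \<times> 'd::finite) mtx"
  assumes Q: "stochastic Q" and T: "stochastic T" and QT: "op_dom Q T" and mT: "op_mono T"
    and "meas_dom \<mu>1 \<nu>" "meas_dom \<mu>2 \<nu>" and f: "\<And>x. f x \<le> 1"
  shows "expect \<mu>1 ((app Q ^^ m) f) \<le> expect \<mu>2 ((app Q ^^ m) f) + expect \<nu> (avoid T m)"
  using assms(5,6)
proof (induction m arbitrary: \<mu>1 \<mu>2 \<nu>)
  case (0 \<mu>1 \<mu>2 \<nu>)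
  note s = meas_dom_split[OF 0(1)] meas_dom_split[OF 0(2)]
  have "expect \<mu>1 f = expect (on0 \<nu>) f + expect (\<lambda>x. \<mu>1 x - on0 \<nu> x) f" by (rule s)
  \<comment> \<open>The common part is counted in \<open>\<mu>2\<close>; the remainder of
    \<open>\<mu>1\<close> is bounded by its mass, which is the mass of \<open>\<nu>\<close> off
    level 0.\<close>
  also have "\<dots> \<le> expect \<mu>2 f + expect (\<lambda>x. \<mu>1 x - on0 \<nu> x) (\<lambda>x. 1)"
    unfolding s(3)[of f] using f by (intro add_mono expect_mono) auto
  also have "expect (\<lambda>x. \<mu>1 x - on0 \<nu> x) (\<lambda>x. 1) = expect \<nu> above0"
    unfolding meas_dom_total[OF s(2)] by (simp add: expect_def mult.commute)
  finally show ?case by simp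
next
  case (Suc m \<mu>1 \<mu>2 \<nu>)
  define g where "g = (app Q ^^ m) f"
  note s = meas_dom_split[OF Suc(2)] meas_dom_split[OF Suc(3)]
  note p = meas_dom_push[OF s(2) Q T QT mT] meas_dom_push[OF s(4) Q T QT mT]
  have "expect \<mu>1 (app Q g) = expect (on0 \<nu>) (app Q g) + expect (push (\<lambda>x. \<mu>1 x - on0 \<nu> x) Q) g"
    unfolding expect_push by (rule s)
  also have "\<dots> \<le> expect (on0 \<nu>) (app Q g) + (expect (push (\<lambda>x. \<mu>2 x - on0 \<nu> x) Q) g
      + expect (push (\<lambda>x. above0 x * \<nu> x) T) (avoid T m))"
    using Suc.IH[OF p] by (intro add_left_mono) (simp add: g_def)
  also have "\<dots> = expect \<mu>2 (app Q g) + expect (push (\<lambda>x. above0 x * \<nu> x) T) (avoid T m)"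
    unfolding expect_push s(3)[of "app Q g"] by (simp add: add.assoc)
  \<comment> \<open>Starting off level 0, making one step of \<open>T\<close> and then avoiding
    level 0 for \<open>m\<close> steps is avoidance for \<open>Suc m\<close> steps.\<close>
  also have "expect (push (\<lambda>x. above0 x * \<nu> x) T) (avoid T m) = expect \<nu> (avoid T (Suc m))"
    unfolding expect_push by (simp add: expect_def mult_ac)
  finally show ?case by (simp add: g_def)
qed

section \<open>Concave rate functions\<close>

lemma mean_value_exists:
  fixes f :: "real \<Rightarrow> real"
  assumes "a < b" "continuous_on {a..b} f"
    and "\<And>x. a < x \<Longrightarrow> x < b \<Longrightarrow> (f has_real_derivative f' x) (at x)"
  shows "\<exists>z. a < z \<and> z < b \<and> f b - f a = (b - a) * f' z"
  using assms by (metis MVT DERIV_unique real_differentiable_def)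


text \<open>The slope over \<open>[a, d]\<close> lies between the slopes over \<open>[c, d]\<close>
  and \<open>[a, b]\<close>, so the two intervals may overlap. The product form spares later uses a
  division.\<close>

lemma concave_slope_mono:
  fixes f :: "real \<Rightarrow> real"
  assumes f: "concave_on A f" and "a \<in> A" "d \<in> A" and "a < b" "c < d" "a \<le> c" "b \<le> d"
  shows "(f d - f c) * (b - a) \<le> (f b - f a) * (d - c)"
proof -
  define g where "g x y = (f x - f y) / (x - y)" for x y
  have A: "x \<in> A" if "a \<le> x" "x \<le> d" for x
    using mem_is_interval_1_I[OF _ assms(2,3) that] concave_on_imp_convex[OF f]
    by (simp add: is_interval_convex_1)
  have e: "(- f x - - f y) / (x - y) = - g x y" for x y
    by (simp add: g_def minus_divide_left)
  have g: "g y z \<le> g x z" "g x z \<le> g x y" if "a \<le> x" "x < y" "y < z" "z \<le> d" for x y z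
    using convex_on_slope_le[of A "\<lambda>x. - f x" x z y] f A[of x] A[of z] that
    unfolding e concave_on_def by auto
  have "g c d \<le> g a d" using g(1)[of a c d] assms by (cases "a = c") auto
  also have "g a d \<le> g a b" using g(2)[of a b d] assms by (cases "b = d") auto
  finally have "(f d - f c) / (d - c) \<le> (f b - f a) / (b - a)"
    unfolding g_def by (metis minus_diff_eq minus_divide_divide)
  then show ?thesis using assms by (simp add: pos_le_divide_eq pos_divide_le_eq mult.commute)
qed

locale concave_rate =
  fixes \<phi> :: "real \<Rightarrow> real"
  assumes pos: "1 \<le> t \<Longrightarrow> 0 < \<phi> t"
    and mono: "mono_on {1..} \<phi>"
    and cont: "continuous_on {1..} \<phi>"
    and conc: "concave_on {1..} \<phi>"
begin

lemma rate_fn_le: "1 \<le> s \<Longrightarrow> s \<le> t \<Longrightarrow> \<phi> s \<le> \<phi> t"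
  using mono by (auto simp: mono_on_def)

lemma rate_fn_slope: "1 \<le> a \<Longrightarrow> a < b \<Longrightarrow> c < d \<Longrightarrow> a \<le> c \<Longrightarrow> b \<le> d \<Longrightarrow>
    (\<phi> d - \<phi> c) * (b - a) \<le> (\<phi> b - \<phi> a) * (d - c)"
  by (rule concave_slope_mono[OF conc]) auto

text \<open>By concavity the increment over length \<open>B\<close> is largest at 1, and
  \<open>\<phi>\<close> is smallest there, so the ratio \<open>\<phi> x / \<phi> (x + B)\<close> is
  least at \<open>x = 1\<close>. This is the source of the constant in \<open>c_fn\<close>.\<close>

lemma rate_fn_shift:
  assumes "1 \<le> x" "0 < B"
  shows "\<phi> 1 / \<phi> (B + 1) * \<phi> (x + B) \<le> \<phi> x"
proof -
  have "(\<phi> (x + B) - \<phi> x) * B \<le> (\<phi> (1 + B) - \<phi> 1) * B"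
    using rate_fn_slope[of 1 "1 + B" x "x + B"] assms by simp
  then have 1: "\<phi> (x + B) - \<phi> x \<le> \<phi> (1 + B) - \<phi> 1"
    using assms by simp
  have p: "0 < \<phi> 1" "0 < \<phi> (B + 1)" using pos assms by auto
  have "\<phi> 1 * \<phi> (x + B) \<le> \<phi> 1 * (\<phi> (1 + B) - \<phi> 1 + \<phi> x)"
    using 1 p by (intro mult_left_mono) auto
  also have "\<dots> = \<phi> 1 * (\<phi> (B + 1) - \<phi> 1) + \<phi> 1 * \<phi> x"
    by (simp add: algebra_simps)
  also have "\<dots> \<le> \<phi> x * (\<phi> (B + 1) - \<phi> 1) + \<phi> 1 * \<phi> x"
    using rate_fn_le[of 1 x] rate_fn_le[of 1 "B + 1"] assms by (intro add_right_mono mult_right_mono) auto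
  also have "\<dots> = \<phi> x * \<phi> (B + 1)" by (simp add: algebra_simps)
  finally show ?thesis using p by (simp add: field_simps)
qed

section \<open>The time change \<open>H\<close> and its inverse \<open>G\<close>\<close>

abbreviation "H \<equiv> H_fn \<phi>"
abbreviation "G \<equiv> H_inv \<phi>"

lemma cont_inv: "continuous_on {1..} (\<lambda>y. 1 / \<phi> y)"
  using pos by (intro continuous_intros cont) (auto simp: less_imp_neq[symmetric])

lemma H_deriv:
  assumes "1 \<le> x" "x < b"
  shows "(H has_real_derivative 1 / \<phi> x) (at x within {1..b})"
  unfolding H_fn_def using assms
  by (intro integral_has_real_derivative continuous_on_subset[OF cont_inv]) auto

lemma H_deriv_at:
  assumes "1 < x"
  shows "(H has_real_derivative 1 / \<phi> x) (at x)"
  using H_deriv[of x "x + 1"] assms by (simp add: at_within_interior[of x "{1..x+1}"])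

lemma H_cont: "continuous_on {1..} H"
  unfolding continuous_on_eq_continuous_within
proof
  fix x :: real assume "x \<in> {1..}"
  then have "continuous (at x within {1..x+1}) H"
    using H_deriv[of x "x + 1"] by (auto intro: DERIV_continuous)
  moreover have "at x within {1..x+1} = at x within {1..}"
    by (rule at_within_nhd[of _ "{x-1<..<x+1}"]) auto
  ultimately show "continuous (at x within {1..}) H" by simp
qed

lemma H_1: "H 1 = 0"
  by (simp add: H_fn_def)

lemma H_diff:
  assumes "1 \<le> x" "x < y"
  obtains z where "x < z" "z < y" "H y - H x = (y - x) / \<phi> z"
proof -
  have "\<exists>z. x < z \<and> z < y \<and> H y - H x = (y - x) * (1 / \<phi> z)"
    using assms H_deriv_at
    by (intro mean_value_exists[where f=H]) (auto intro!: continuous_on_subset[OF H_cont])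
  then show thesis using that by auto
qed

lemma H_less: "1 \<le> x \<Longrightarrow> x < y \<Longrightarrow> H x < H y"
proof -
  assume "1 \<le> x" "x < y"
  then obtain z where z: "x < z" "z < y" "H y - H x = (y - x) / \<phi> z" by (rule H_diff)
  with \<open>1 \<le> x\<close> have "0 < \<phi> z" by (intro pos) auto
  with z show ?thesis by (smt (verit) divide_pos_pos)
qed

lemma H_le_iff: "1 \<le> x \<Longrightarrow> 1 \<le> y \<Longrightarrow> H x \<le> H y \<longleftrightarrow> x \<le> y"
  using H_less[of x y] H_less[of y x] by (cases x y rule: linorder_cases) auto

lemma H_nonneg: "1 \<le> x \<Longrightarrow> 0 \<le> H x"
  using H_le_iff[of 1 x] by (simp add: H_1)

text \<open>Concavity bounds \<open>\<phi>\<close> by a linear function, so \<open>H\<close> grows at least logarithmically.\<close>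

lemma rate_fn_linear: "1 \<le> y \<Longrightarrow> \<phi> y \<le> \<phi> 2 * y"
proof (cases "2 < y")
  case True
  then have "\<phi> y - \<phi> 1 \<le> (\<phi> 2 - \<phi> 1) * (y - 1)"
    using rate_fn_slope[of 1 2 1 y] by simp
  also have "(\<phi> 2 - \<phi> 1) * (y - 1) = \<phi> 2 * y - \<phi> 2 - \<phi> 1 - \<phi> 1 * (y - 2)"
    by (simp add: algebra_simps)
  finally show ?thesis using True pos[of 1] pos[of 2] mult_nonneg_nonneg[of "\<phi> 1" "y - 2"]
    by linarith
next
  assume "1 \<le> y"
  case False
  then have "\<phi> y \<le> \<phi> 2 * 1" using rate_fn_le[of y 2] \<open>1 \<le> y\<close> by simp
  also have "\<dots> \<le> \<phi> 2 * y" using pos[of 2] \<open>1 \<le> y\<close> by (intro mult_left_mono) auto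
  finally show ?thesis .
qed

lemma H_lower:
  assumes "1 \<le> x"
  shows "ln x / \<phi> 2 \<le> H x"
proof (cases "x = 1")
  case False
  have "\<exists>z. 1 < z \<and> z < x \<and> (H x - ln x / \<phi> 2) - (H 1 - ln 1 / \<phi> 2)
      = (x - 1) * (1 / \<phi> z - 1 / z / \<phi> 2)"
    using assms False pos[of 2]
    by (intro mean_value_exists[where f="\<lambda>x. H x - ln x / \<phi> 2"])
      (auto intro!: continuous_intros continuous_on_subset[OF H_cont] derivative_eq_intros H_deriv_at
        simp: inverse_eq_divide)
  then obtain z where z: "1 < z" "(H x - ln x / \<phi> 2) = (x - 1) * (1 / \<phi> z - 1 / z / \<phi> 2)"
    by (auto simp: H_1)
  have "1 / z / \<phi> 2 \<le> 1 / \<phi> z"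
    using rate_fn_linear[of z] z pos[of z] pos[of 2] by (simp add: field_simps)
  then have "0 \<le> (x - 1) * (1 / \<phi> z - 1 / z / \<phi> 2)" using assms by simp
  then show ?thesis using z by simp
qed (simp add: H_1)

lemma H_surj:
  assumes "0 \<le> u" shows "\<exists>x\<ge>1. H x = u"
proof -
  \<comment> \<open>Chosen so that the lower bound of \<open>H_lower\<close> at \<open>X\<close>
    equals \<open>u\<close>.\<close>
  define X where "X = exp (u * \<phi> 2)"
  have X: "1 \<le> X" using assms pos[of 2] by (simp add: X_def)
  have "u \<le> H X" using H_lower[OF X] pos[of 2] by (simp add: X_def)
  then have "\<exists>x\<ge>1. x \<le> X \<and> H x = u"
    using X assms by (intro IVT') (auto simp: H_1 intro: continuous_on_subset[OF H_cont])
  then show ?thesis by blast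
qed

lemma inj_H: "inj_on H {1..}"
  by (rule linorder_inj_onI) (use H_less in fastforce)+

lemma G_H: "1 \<le> x \<Longrightarrow> G (H x) = x"
  unfolding H_inv_def by (rule the_inv_into_f_f[OF inj_H]) simp

lemma G: assumes "0 \<le> u" shows H_G: "H (G u) = u" and G_ge: "1 \<le> G u"
  using H_surj[OF assms] G_H by auto

lemma G_mono: "0 \<le> u \<Longrightarrow> u \<le> u' \<Longrightarrow> G u \<le> G u'"
  using H_le_iff[of "G u" "G u'"] G[of u] G[of u'] by auto

text \<open>By the mean value theorem the increment is \<open>c * \<phi> z\<close> for an
  intermediate \<open>z\<close>; monotonicity of \<open>\<phi>\<close> replaces \<open>z\<close> by
  either end.\<close>

lemma G_step:
  assumes "0 \<le> a" "0 < c"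
  shows "G (a + c) - G a \<le> c * \<phi> (G (a + c))" "c * \<phi> (G a) \<le> G (a + c) - G a"
proof -
  have g: "1 \<le> G a" "1 \<le> G (a + c)" "H (G (a + c)) - H (G a) = c" using assms by (auto simp: G)
  then have "G a < G (a + c)" using G_mono[of a "a + c"] assms by (cases "G a = G (a + c)") auto
  then obtain z where z: "G a < z" "z < G (a + c)" "c = (G (a + c) - G a) / \<phi> z"
    using H_diff[OF g(1)] g(3) by metis
  have "G (a + c) - G a = c * \<phi> z" using z(3) pos[of z] g(1) z(1) by (simp add: field_simps)
  then show "G (a + c) - G a \<le> c * \<phi> (G (a + c))" "c * \<phi> (G a) \<le> G (a + c) - G a"
    using assms z g by (auto intro!: mult_left_mono rate_fn_le)
qed

text \<open>The flow \<open>s \<mapsto> G (H s + u)\<close> of the equation \<open>y' = \<phi> y\<close> is concave in its starting point; this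
  is its tangent line at \<open>t\<close>.\<close>

lemma flow_tangent:
  assumes "0 \<le> u" "1 \<le> s" "1 \<le> t"
  defines "T \<equiv> G (H t + u)"
  shows "G (H s + u) \<le> T + \<phi> T / \<phi> t * (s - t)"
proof -
  \<comment> \<open>\<open>\<rho>\<close> is the derivative of the flow in its starting point at
    \<open>t\<close>, and \<open>L\<close> is the tangent line. The claim becomes
    \<open>u \<le> H (L s) - H s\<close>, with equality at \<open>s = t\<close>.\<close>
  define \<rho> where "\<rho> = \<phi> T / \<phi> t"
  define L where "L y = T + \<rho> * (y - t)" for y
  have T: "H T = H t + u" "1 \<le> T" using H_nonneg[OF assms(3)] assms(1) by (auto simp: T_def G)
  have tT: "t \<le> T" using H_le_iff[of t T] assms T by simp
  have \<phi>: "0 < \<phi> t" "0 < \<phi> T" using pos assms T by auto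
  have \<rho>: "1 \<le> \<rho>" using rate_fn_le[OF assms(3) tT] \<phi> by (simp add: \<rho>_def)
  have \<phi>T: "\<phi> T = \<rho> * \<phi> t" using \<phi> by (simp add: \<rho>_def)
  \<comment> \<open>The line stays on or above the diagonal, hence in the domain of
    \<open>H\<close>; left of \<open>t\<close> this follows from concavity on \<open>[y, t]\<close>
    and \<open>[t, T]\<close>.\<close>
  have Ly: "y \<le> L y" if "1 \<le> y" for y
  proof (cases "t \<le> y")
    case True
    then have "y - t \<le> \<rho> * (y - t)" using mult_right_mono[OF \<rho>, of "y - t"] by simp
    then show ?thesis using tT by (simp add: L_def)
  next
    case False
    have "(\<rho> - 1) * (t - y) \<le> T - t"
    proof (cases "t = T")
      case True
      then show ?thesis using \<phi> by (simp add: \<rho>_def)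
    next
      case ne: False
      have "(\<phi> T - \<phi> t) * (t - y) \<le> (\<phi> t - \<phi> y) * (T - t)"
        using rate_fn_slope[of y t t T] that False tT ne by simp
      also have "\<dots> \<le> \<phi> t * (T - t)"
        using pos[OF that] tT by (intro mult_right_mono) auto
      finally have "\<phi> t * ((\<rho> - 1) * (t - y)) \<le> \<phi> t * (T - t)"
        by (simp add: \<phi>T algebra_simps)
      then show ?thesis using \<phi> by simp
    qed
    then show ?thesis by (simp add: L_def algebra_simps)
  qed
  have L1: "1 < L y" if "1 < y" for y using Ly[of y] that by simp
  have d: "((\<lambda>y. H (L y) - H y) has_real_derivative (\<rho> / \<phi> (L y) - 1 / \<phi> y)) (at y)" if "1 < y" for y
  proof -
    have "(L has_real_derivative \<rho>) (at y)"
      unfolding L_def by (auto intro!: derivative_eq_intros)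
    then show ?thesis
      using DERIV_diff[OF DERIV_chain2[where f=H and g=L, OF H_deriv_at[OF L1[OF that]]] H_deriv_at[OF that]]
      by simp
  qed
  have c: "continuous_on {1..} (\<lambda>y. H (L y) - H y)"
  proof -
    have "continuous_on {1..} L" unfolding L_def by (intro continuous_intros)
    then show ?thesis
      using Ly by (intro continuous_intros H_cont continuous_on_compose2[OF H_cont]) fastforce+
  qed
  have mvt: "\<exists>z. x < z \<and> z < y \<and> (H (L y) - H y) - (H (L x) - H x)
      = (y - x) * (\<rho> / \<phi> (L z) - 1 / \<phi> z)" if "1 \<le> x" "x < y" for x y
    using that by (intro mean_value_exists[where f="\<lambda>y. H (L y) - H y"] continuous_on_subset[OF c] d) auto
  have Lt: "L t = T" by (simp add: L_def)
  \<comment> \<open>The function \<open>y \<mapsto> H (L y) - H y\<close> has its minimum at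
    \<open>t\<close>: comparing a chord of \<open>\<phi>\<close> between \<open>z\<close> and
    \<open>t\<close> with the chord over the image under \<open>L\<close> gives the sign of the
    derivative on each side.\<close>
  have "H t + u - H t \<le> H (L s) - H s"
  proof (cases s t rule: linorder_cases)
    case less
    then obtain z where z: "s < z" "z < t" "(H (L t) - H t) - (H (L s) - H s) = (t - s) * (\<rho> / \<phi> (L z) - 1 / \<phi> z)"
      using mvt[OF assms(2)] by blast
    have TL: "T - L z = \<rho> * (t - z)" by (simp add: L_def algebra_simps)
    moreover have "0 < \<rho> * (t - z)" using z \<rho> by simp
    ultimately have "(\<phi> T - \<phi> (L z)) * (t - z) \<le> (\<phi> t - \<phi> z) * (T - L z)"
      using z assms(2) Ly[of z] tT by (intro rate_fn_slope) linarith+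
    then have "(\<phi> T - \<phi> (L z)) * (t - z) \<le> (\<rho> * (\<phi> t - \<phi> z)) * (t - z)"
      unfolding TL by (simp only: mult_ac)
    then have "\<phi> T - \<phi> (L z) \<le> \<rho> * (\<phi> t - \<phi> z)" by (rule mult_right_le_imp_le) (use z in simp)
    then have "\<rho> * \<phi> z \<le> \<phi> (L z)" using \<phi>T by (simp add: right_diff_distrib)
    then have "\<rho> / \<phi> (L z) - 1 / \<phi> z \<le> 0"
      using pos[of z] pos[of "L z"] Ly[of z] z assms by (simp add: field_simps)
    then have "(t - s) * (\<rho> / \<phi> (L z) - 1 / \<phi> z) \<le> 0" using less by (simp add: mult_nonneg_nonpos)
    then show ?thesis using z(3) T unfolding Lt by linarith
  next
    case equal
    then show ?thesis using T Lt by simp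
  next
    case greater
    then obtain z where z: "t < z" "z < s" "(H (L s) - H s) - (H (L t) - H t) = (s - t) * (\<rho> / \<phi> (L z) - 1 / \<phi> z)"
      using mvt[OF assms(3)] by blast
    have TL: "L z - T = \<rho> * (z - t)" by (simp add: L_def)
    moreover have "0 < \<rho> * (z - t)" using z \<rho> by simp
    ultimately have "(\<phi> (L z) - \<phi> T) * (z - t) \<le> (\<phi> z - \<phi> t) * (L z - T)"
      using z assms(3) Ly[of z] tT by (intro rate_fn_slope) linarith+
    then have "(\<phi> (L z) - \<phi> T) * (z - t) \<le> (\<rho> * (\<phi> z - \<phi> t)) * (z - t)"
      unfolding TL by (simp only: mult_ac)
    then have "\<phi> (L z) - \<phi> T \<le> \<rho> * (\<phi> z - \<phi> t)" by (rule mult_right_le_imp_le) (use z in simp)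
    then have "\<phi> (L z) \<le> \<rho> * \<phi> z" using \<phi>T by (simp add: right_diff_distrib)
    then have "0 \<le> \<rho> / \<phi> (L z) - 1 / \<phi> z"
      using pos[of z] pos[of "L z"] Ly[of z] z assms by (simp add: field_simps)
    then have "0 \<le> (s - t) * (\<rho> / \<phi> (L z) - 1 / \<phi> z)" using greater by simp
    then show ?thesis using z(3) T unfolding Lt by linarith
  qed
  then have "H (G (H s + u)) \<le> H (L s)" using H_nonneg[OF assms(2)] assms(1) by (simp add: G)
  then have "G (H s + u) \<le> L s"
    using H_le_iff[of "G (H s + u)" "L s"] G_ge[of "H s + u"] H_nonneg[OF assms(2)] Ly[OF assms(2)] assms by simp
  then show ?thesis by (simp add: L_def \<rho>_def)
qed

end

section \<open>Subgeometric bounds for avoiding level 0\<close>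

lemma app_const: "stochastic T \<Longrightarrow> app T (\<lambda>y. k) x = k"
  using app_cmult[of T k "\<lambda>y. 1" x] by (simp add: stochastic_app_one)

lemma expect_on0:
  fixes p g :: "nat \<times> 'd::finite \<Rightarrow> ennreal"
  shows "expect p (on0 g) = (\<Sum>i\<in>UNIV. p (0, i) * g (0, i))"
proof -
  have "expect p (on0 g) = (\<Sum>i\<in>UNIV. \<integral>\<^sup>+(k::nat). p (0, i) * g (0, i) * (if k = 0 then 1 else 0) \<partial>count_space UNIV)"
    unfolding expect_def nn_integral_levels
    by (intro sum.cong nn_integral_cong refl) (auto simp: on0_def intro!: nn_integral_cong)
  then show ?thesis
    unfolding nn_integral_delta[of "\<lambda>k. p (0, i) * g (0, i)" 0 for i] .
qed

context concave_rate
begin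

text \<open>The flow of \<open>y' = \<phi> y\<close> after time \<open>c * j\<close> from
  \<open>w x\<close>, minus the same flow from 1 (where \<open>H 1 = 0\<close>). For
  \<open>j = 0\<close> this is \<open>w x - 1\<close>.\<close>

definition V :: "('s \<Rightarrow> real) \<Rightarrow> real \<Rightarrow> nat \<Rightarrow> 's \<Rightarrow> real" where
  "V w c j x = G (H (w x) + c * real j) - G (c * real j)"

text \<open>The speed at time \<open>j\<close> of the reference flow
  \<open>t \<mapsto> G (c * t)\<close> started at 1.\<close>

definition rate :: "real \<Rightarrow> nat \<Rightarrow> real" where
  "rate c j = c * r_fn \<phi> (c * real j)"

lemma rate_pos: "0 < c \<Longrightarrow> 0 < rate c j"
  by (simp add: rate_def r_fn_def pos G_ge)

lemma rate_mono: "0 < c \<Longrightarrow> i \<le> j \<Longrightarrow> rate c i \<le> rate c j"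
  unfolding rate_def r_fn_def by (intro mult_left_mono rate_fn_le G_mono G_ge) auto

lemma V_0: "1 \<le> w x \<Longrightarrow> V w c 0 x \<le> w x"
  using G_H[of 1] by (simp add: V_def G_H H_1)

text \<open>The tangent line of the flow at \<open>w x\<close> is affine in \<open>w y\<close>, so
  the drift of \<open>w\<close> applies to it. Its slope \<open>\<phi> F / \<phi> t\<close> turns
  the gain \<open>c * \<phi> t\<close> into \<open>c * \<phi> F\<close>, which pays for one step of
  the flow; the growth of the reference flow leaves \<open>rate c j\<close>.\<close>

lemma drift_step:
  assumes T: "stochastic T" and c: "0 < c" and w: "\<And>x. 1 \<le> w x"
    and drift: "app T (\<lambda>y. ennreal (w y)) x \<le> ennreal (w x - c * \<phi> (w x))"
  shows "app T (\<lambda>y. ennreal (V w c (Suc j) y)) x + ennreal (rate c j) \<le> ennreal (V w c j x)"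
proof -
  define u where "u = c * real j"
  have u: "0 \<le> u" "c * real (Suc j) = u + c" using c by (simp_all add: u_def algebra_simps)
  define t where "t = w x"
  define F where "F = G (H t + (u + c))"
  define \<rho> where "\<rho> = \<phi> F / \<phi> t"
  define C where "C = F - G (u + c)"
  have t: "1 \<le> t" "0 \<le> H t" using w[of x] H_nonneg by (auto simp: t_def)
  have F: "1 \<le> F" using G_ge[of "H t + (u + c)"] t u c by (simp add: F_def)
  have \<rho>: "0 \<le> \<rho>" using pos[OF F] pos[OF t(1)] by (simp add: \<rho>_def)
  have C: "0 \<le> C" using G_mono[of "u + c" "H t + (u + c)"] t u c by (simp add: C_def F_def)
  have V: "0 \<le> V w c (Suc j) y" for y
    unfolding V_def u using G_mono[of "u + c" "H (w y) + (u + c)"] H_nonneg[OF w[of y]] u c by simp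
  \<comment> \<open>Since \<open>w \<ge> 1\<close>, the bound in \<open>drift\<close> is at least 1,
    so \<open>ennreal\<close> does not clip it at 0.\<close>
  have "1 \<le> app T (\<lambda>y. ennreal (w y)) x"
    using app_mono[of "\<lambda>x. 1" "\<lambda>y. ennreal (w y)" T x] w T by (simp add: stochastic_app_one)
  then have td: "0 \<le> t - c * \<phi> t"
    using order_trans[OF _ drift, of 1] by (simp add: t_def)
  \<comment> \<open>The negative term of the tangent line is carried on the left, so that every
    quantity stays nonnegative.\<close>
  have "app T (\<lambda>y. ennreal (V w c (Suc j) y)) x + ennreal (\<rho> * t)
      = app T (\<lambda>y. ennreal (V w c (Suc j) y) + ennreal (\<rho> * t)) x"
    by (simp add: app_add app_const[OF T])
  also have "\<dots> \<le> app T (\<lambda>y. ennreal C + ennreal \<rho> * ennreal (w y)) x"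
  proof (rule app_mono)
    fix y
    have "G (H (w y) + (u + c)) \<le> F + \<rho> * (w y - t)"
      unfolding \<rho>_def F_def using t w[of y] u c by (intro flow_tangent) auto
    then have "V w c (Suc j) y + \<rho> * t \<le> C + \<rho> * w y"
      unfolding V_def u(2) C_def right_diff_distrib by linarith
    then show "ennreal (V w c (Suc j) y) + ennreal (\<rho> * t) \<le> ennreal C + ennreal \<rho> * ennreal (w y)"
      using V[of y] \<rho> t C w[of y] by (simp flip: ennreal_plus ennreal_mult)
  qed
  also have "\<dots> = ennreal C + ennreal \<rho> * app T (\<lambda>y. ennreal (w y)) x"
    by (simp add: app_add app_const[OF T] app_cmult)
  also have "\<dots> \<le> ennreal C + ennreal \<rho> * ennreal (t - c * \<phi> t)"
    using drift by (intro add_left_mono mult_left_mono) (auto simp: t_def)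
  also have "\<dots> = ennreal (C + \<rho> * (t - c * \<phi> t))"
    using C \<rho> td by (simp flip: ennreal_plus ennreal_mult)
  also have "C + \<rho> * (t - c * \<phi> t) = (C - c * \<phi> F) + \<rho> * t"
    using pos[OF t(1)] by (simp add: \<rho>_def field_simps)
  finally have le: "app T (\<lambda>y. ennreal (V w c (Suc j) y)) x + ennreal (\<rho> * t)
      \<le> ennreal (C - c * \<phi> F + \<rho> * t)" .
  then have "app T (\<lambda>y. ennreal (V w c (Suc j) y)) x \<noteq> top"
    by (auto simp: top_unique)
  then obtain a where a: "0 \<le> a" "app T (\<lambda>y. ennreal (V w c (Suc j) y)) x = ennreal a"
    by (cases "app T (\<lambda>y. ennreal (V w c (Suc j) y)) x") auto
  have \<rho>t: "0 \<le> \<rho> * t" using \<rho> t by simp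
  have p: "0 \<le> C + \<rho> * (t - c * \<phi> t)" using C \<rho> td by simp
  have "a + \<rho> * t \<le> C - c * \<phi> F + \<rho> * t"
    using le a \<rho>t p \<open>C + \<rho> * (t - c * \<phi> t) = (C - c * \<phi> F) + \<rho> * t\<close>
    by (simp flip: ennreal_plus)
  \<comment> \<open>The upper estimate of \<open>G_step\<close> serves the flow from
    \<open>w x\<close>, the lower one the reference flow.\<close>
  moreover have "F - G (H t + u) \<le> c * \<phi> F"
    using G_step(1)[of "H t + u" c] t u c by (simp add: F_def add.assoc)
  moreover have "c * \<phi> (G u) \<le> G (u + c) - G u"
    using G_step(2)[of u c] u c by simp
  moreover have "rate c j = c * \<phi> (G u)" by (simp add: rate_def r_fn_def u_def)
  moreover have "V w c j x = G (H t + u) - G u" by (simp add: V_def t_def u_def)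
  ultimately have "a + rate c j \<le> V w c j x" by (simp add: C_def)
  then show ?thesis using a rate_pos[OF c, of j] by (simp flip: ennreal_plus)
qed

context
  fixes T :: "(nat \<times> 'd::finite) mtx" and w :: "nat \<times> 'd \<Rightarrow> real" and c :: real
  assumes T: "stochastic T" and mT: "op_mono T" and c: "0 < c" and w: "\<And>x. 1 \<le> w x"
    and drift: "\<And>x. 0 < fst x \<Longrightarrow> app T (\<lambda>y. ennreal (w y)) x \<le> ennreal (w x - c * \<phi> (w x))"
begin

text \<open>\<open>drift_step\<close> telescopes along the path until level 0 is reached: the left
  side is the expected total rate collected before that time, within \<open>N\<close> steps. The
  index \<open>u\<close> is free because the induction advances it at each step.\<close>

lemma avoid_sum:
  "(\<Sum>j<N. ennreal (rate c (u + j)) * avoid T j x) \<le> ennreal (V w c u x)"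
proof (induction N arbitrary: u x)
  case (Suc N)
  show ?case
  proof (cases "fst x = 0")
    case True
    then have "avoid T j x = 0" for j using avoid_level0[of T j "snd x"] by (metis prod.collapse)
    then show ?thesis by simp
  next
    case False
    have "(\<Sum>j<Suc N. ennreal (rate c (u + j)) * avoid T j x)
        = ennreal (rate c u) + (\<Sum>j<N. ennreal (rate c (Suc u + j)) * app T (avoid T j) x)"
      using False unfolding sum.lessThan_Suc_shift by (simp add: above0_def)
    also have "\<dots> = ennreal (rate c u) + app T (\<lambda>y. \<Sum>j<N. ennreal (rate c (Suc u + j)) * avoid T j y) x"
      by (simp add: app_sum app_cmult)
    also have "\<dots> \<le> ennreal (rate c u) + app T (\<lambda>y. ennreal (V w c (Suc u) y)) x"
      by (intro add_left_mono app_mono Suc)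
    also have "\<dots> \<le> ennreal (V w c u x)"
      using drift_step[OF T c w drift, of x u] False by (simp add: add.commute)
    finally show ?thesis .
  qed
qed simp

lemma avoid_antimono_le: "i \<le> j \<Longrightarrow> avoid T j x \<le> avoid T i x"
  by (rule lift_Suc_antimono_le[of "\<lambda>k. avoid T k x"]) (rule avoid_antimono[OF T])

text \<open>Rates are at least \<open>rate c 0\<close> and avoidance probabilities decrease, so
  \<open>avoid_sum\<close> gives decay of order \<open>1 / N\<close>.\<close>

lemma avoid_tendsto: "(\<lambda>N. avoid T N x) \<longlonglongrightarrow> 0"
proof -
  have le: "avoid T N x \<le> ennreal (w x / rate c 0 / real N)" if "0 < N" for N
  proof -
    have "of_nat N * (ennreal (rate c 0) * avoid T N x) = (\<Sum>j<N. ennreal (rate c 0) * avoid T N x)"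
      by simp
    also have "\<dots> \<le> (\<Sum>j<N. ennreal (rate c (0 + j)) * avoid T j x)"
      using rate_mono[OF c, of 0] by (intro sum_mono mult_mono avoid_antimono_le) (auto intro: ennreal_leI)
    also have "\<dots> \<le> ennreal (w x)"
      using avoid_sum[of 0 x N] V_0[of w x c] w[of x] by (meson ennreal_leI order_trans)
    finally have *: "of_nat N * (ennreal (rate c 0) * avoid T N x) \<le> ennreal (w x)" .
    obtain a where a: "0 \<le> a" "avoid T N x = ennreal a"
      using avoid_le_one[OF T, of N x] by (cases "avoid T N x") (auto simp: top_unique)
    have "real N * (rate c 0 * a) \<le> w x"
      using * w[of x] a rate_pos[OF c, of 0]
      by (simp add: a ennreal_of_nat_eq_real_of_nat flip: ennreal_mult)
    then show ?thesis using that rate_pos[OF c, of 0] a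
      by (auto intro!: ennreal_leI simp: field_simps)
  qed
  have "(\<lambda>N. w x / rate c 0 / real N) \<longlonglongrightarrow> 0"
    by (rule lim_const_over_n)
  then have lim: "(\<lambda>N. ennreal (w x / rate c 0 / real N)) \<longlonglongrightarrow> 0"
    using tendsto_ennrealI by fastforce
  show ?thesis
  proof (rule tendsto_sandwich[OF _ _ tendsto_const lim])
    show "\<forall>\<^sub>F N in sequentially. avoid T N x \<le> ennreal (w x / rate c 0 / real N)"
      by (rule eventually_sequentiallyI[of 1]) (rule le, simp)
  qed simp
qed

text \<open>By monotonicity the drift on level \<open>1\<close> also controls the excursions that start on level \<open>0\<close>.\<close>

lemma excursion_sum:
  "(\<Sum>j<N. app T (avoid T (m + j)) (0, i)) \<le> ennreal (w (1, i) / rate c (Suc m))"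
proof -
  let ?r = "ennreal (rate c (Suc m))"
  have "?r * (\<Sum>j<N. app T (avoid T (m + j)) (0, i)) \<le> ?r * (\<Sum>j<N. app T (avoid T (m + j)) (1, i))"
    using mT binc_avoid[OF mT] by (intro mult_left_mono sum_mono) (auto simp: op_mono_def binc_def)
  also have "\<dots> = app T (\<lambda>y. \<Sum>j<N. ?r * avoid T (m + j) y) (1, i)"
    by (simp add: app_sum app_cmult sum_distrib_left)
  \<comment> \<open>One step from \<open>(1, i)\<close> has been made, so the clock of
    \<open>avoid_sum\<close> starts at 1. Terms with \<open>k < m\<close> are added; the others
    carry at least \<open>rate c (Suc m)\<close>.\<close>
  also have "\<dots> \<le> app T (\<lambda>y. \<Sum>k<m + N. ennreal (rate c (1 + k)) * avoid T k y) (1, i)"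
  proof (rule app_mono)
    fix y
    have "(\<Sum>j<N. ?r * avoid T (m + j) y) \<le> (\<Sum>j<N. ennreal (rate c (1 + (m + j))) * avoid T (m + j) y)"
      using rate_mono[OF c] by (intro sum_mono mult_right_mono ennreal_leI) auto
    also have "\<dots> = (\<Sum>k\<in>(+) m ` {..<N}. ennreal (rate c (1 + k)) * avoid T k y)"
      by (subst sum.reindex) auto
    also have "\<dots> \<le> (\<Sum>k<m + N. ennreal (rate c (1 + k)) * avoid T k y)"
      by (intro sum_mono2) auto
    finally show "(\<Sum>j<N. ?r * avoid T (m + j) y) \<le> (\<Sum>k<m + N. ennreal (rate c (1 + k)) * avoid T k y)" .
  qed
  also have "\<dots> \<le> app T (\<lambda>y. ennreal (V w c 1 y)) (1, i)"
    by (rule app_mono) (rule avoid_sum)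
  also have "\<dots> \<le> ennreal (V w c 0 (1, i))"
    using drift_step[OF T c w drift, of "(1, i)" 0] by (auto intro: order_trans[rotated])
  also have "\<dots> \<le> ennreal (w (1, i))" by (intro ennreal_leI V_0 w)
  finally have *: "?r * (\<Sum>j<N. app T (avoid T (m + j)) (0, i)) \<le> ennreal (w (1, i))" .
  have "(\<Sum>j<N. app T (avoid T (m + j)) (0, i)) \<le> (\<Sum>j<N. 1)"
    by (intro sum_mono app_le_one T avoid_le_one)
  then obtain a where a: "0 \<le> a" "(\<Sum>j<N. app T (avoid T (m + j)) (0, i)) = ennreal a"
    by (cases "\<Sum>j<N. app T (avoid T (m + j)) (0, i)") (auto simp: top_unique)
  have "rate c (Suc m) * a \<le> w (1, i)"
    using * w[of "(1, i)"] a rate_pos[OF c, of "Suc m"] by (simp add: a flip: ennreal_mult)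
  then show ?thesis
    unfolding a(2) using rate_pos[OF c, of "Suc m"] by (intro ennreal_leI) (simp add: field_simps)
qed

text \<open>Subinvariance of \<open>p\<close> on block increasing functions is what stationary
  vectors of dominated chains satisfy. A path off level 0 is traced back to its last visit to level
  0; summing over that time leads to \<open>excursion_sum\<close>, and the paths without such a
  visit vanish in the limit.\<close>

lemma stationary_avoid:
  assumes tot: "expect p (\<lambda>x. 1) = 1"
    and sub: "\<And>f. binc f \<Longrightarrow> expect p f \<le> expect p (app T f)"
    and \<omega>: "\<And>i. p (0, i) \<le> ennreal (\<omega> i)" "\<And>i. 0 \<le> \<omega> i"
  shows "expect p (avoid T m) \<le> ennreal (level_avg w 1 \<omega> / rate c (Suc m))"
proof -
  have step: "expect p (avoid T k) \<le> expect p (avoid T (Suc k)) + (\<Sum>i\<in>UNIV. p (0, i) * app T (avoid T k) (0, i))" for k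
  proof -
    have "expect p (avoid T k) \<le> expect p (app T (avoid T k))"
      by (rule sub) (rule binc_avoid[OF mT])
    \<comment> \<open>Off level 0 this is the recursion of \<open>avoid\<close>; on level 0 an
      excursion starts.\<close>
    also have "app T (avoid T k) = (\<lambda>x. avoid T (Suc k) x + on0 (app T (avoid T k)) x)"
      by (auto simp: fun_eq_iff above0_def on0_def)
    also have "expect p \<dots> = expect p (avoid T (Suc k)) + (\<Sum>i\<in>UNIV. p (0, i) * app T (avoid T k) (0, i))"
      unfolding expect_add expect_on0 ..
    finally show ?thesis .
  qed
  have iter: "expect p (avoid T m) \<le> expect p (avoid T (m + N))
      + (\<Sum>i\<in>UNIV. p (0, i) * (\<Sum>j<N. app T (avoid T (m + j)) (0, i)))" for N
  proof (induction N)
    case (Suc N)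
    note Suc
    also have "expect p (avoid T (m + N)) + (\<Sum>i\<in>UNIV. p (0, i) * (\<Sum>j<N. app T (avoid T (m + j)) (0, i)))
      \<le> (expect p (avoid T (Suc (m + N))) + (\<Sum>i\<in>UNIV. p (0, i) * app T (avoid T (m + N)) (0, i)))
        + (\<Sum>i\<in>UNIV. p (0, i) * (\<Sum>j<N. app T (avoid T (m + j)) (0, i)))"
      by (intro add_right_mono step)
    also have "\<dots> = expect p (avoid T (m + Suc N)) + (\<Sum>i\<in>UNIV. p (0, i) * (\<Sum>j<Suc N. app T (avoid T (m + j)) (0, i)))"
      by (simp add: distrib_left sum.distrib add_ac)
    finally show ?case .
  qed simp
  let ?S = "\<Sum>i\<in>UNIV. ennreal (\<omega> i) * ennreal (w (1, i) / rate c (Suc m))"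
  have "expect p (avoid T m) \<le> expect p (avoid T (m + N)) + ?S" for N
    by (rule order_trans[OF iter[of N]]) (intro add_left_mono sum_mono mult_mono \<omega> excursion_sum; simp)
  moreover have "(\<lambda>N. expect p (avoid T (m + N)) + ?S) \<longlonglongrightarrow> 0 + ?S"
  proof (intro tendsto_add tendsto_const)
    have "(\<lambda>N. expect p (avoid T N)) \<longlonglongrightarrow> (\<integral>\<^sup>+(x::nat \<times> 'd). 0 \<partial>count_space UNIV)"
      unfolding expect_def
    proof (rule nn_integral_dominated_convergence[where w=p])
      show "(\<integral>\<^sup>+x. p x \<partial>count_space UNIV) < \<infinity>" using tot by (simp add: expect_def)
      show "AE x in count_space UNIV. p x * avoid T j x \<le> p x" for j
        using mult_left_mono[OF avoid_le_one[OF T], of "p x" j x for x] by simp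
      have "p x \<noteq> top" for x
      proof -
        have "p x = expect p (\<lambda>y. if y = x then 1 else 0)" by (simp add: expect_delta)
        also have "\<dots> \<le> expect p (\<lambda>x. 1)" by (rule expect_mono) simp
        finally show ?thesis using tot by (auto simp: top_unique)
      qed
      then show "AE x in count_space UNIV. (\<lambda>i. p x * avoid T i x) \<longlonglongrightarrow> 0"
        using ennreal_tendsto_cmult[OF _ avoid_tendsto, of "p x" x for x] by (simp add: less_top)
    qed auto
    then show "(\<lambda>N. expect p (avoid T (m + N))) \<longlonglongrightarrow> 0"
      using LIMSEQ_ignore_initial_segment[of "\<lambda>N. expect p (avoid T N)" 0 m] by (simp add: add.commute)
  qed
  ultimately have "expect p (avoid T m) \<le> 0 + ?S"
    by (intro LIMSEQ_le_const) auto
  also have "0 + ?S = ennreal (\<Sum>i\<in>UNIV. \<omega> i * (w (1, i) / rate c (Suc m)))"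
  proof -
    have "0 \<le> w (1, i) / rate c (Suc m)" for i
      using w[of "(1, i)"] rate_pos[OF c, of "Suc m"] by simp
    then show ?thesis using \<omega>(2)
      by (subst sum_ennreal[symmetric]) (auto simp: ennreal_mult simp del: times_divide_eq_right)
  qed
  also have "(\<Sum>i\<in>UNIV. \<omega> i * (w (1, i) / rate c (Suc m))) = level_avg w 1 \<omega> / rate c (Suc m)"
    by (simp add: level_avg_def sum_divide_distrib)
  finally show ?thesis .
qed

end
end

section \<open>Phases and truncations\<close>

lemma has_sum_finite_UNIV: "(f has_sum s) UNIV \<Longrightarrow> (\<Sum>i\<in>UNIV. f i) = s"
  for f :: "'d::finite \<Rightarrow> real"
  by (simp add: has_sum_finite_iff)

text \<open>The positive part \<open>d\<close> of \<open>p - q\<close> is subinvariant and, as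
  \<open>A\<close> preserves total mass, invariant. If it were nonzero, irreducibility would make it
  positive everywhere, against the equal totals; so \<open>p \<le> q\<close>, and equal totals give
  equality.\<close>

lemma finite_stationary_unique:
  fixes A :: "'d::finite mtx"
  assumes A: "stochastic A" and irr: "irreducible_mtx A"
    and p: "\<And>j. p j = (\<Sum>i\<in>UNIV. p i * A i j)" and q: "\<And>j. q j = (\<Sum>i\<in>UNIV. q i * A i j)"
    and pq: "(\<Sum>i\<in>UNIV. p i) = (\<Sum>i\<in>UNIV. q i)"
  shows "p = q"
proof -
  have row: "(\<Sum>j\<in>UNIV. A i j) = 1" for i
    using A by (simp add: stochastic_def prob_vec_def has_sum_finite_UNIV)
  define d where "d i = max (p i - q i) 0" for i
  have sub: "d j \<le> (\<Sum>i\<in>UNIV. d i * A i j)" for j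
  proof -
    have "p j - q j = (\<Sum>i\<in>UNIV. (p i - q i) * A i j)"
      using p[of j] q[of j] by (simp add: left_diff_distrib sum_subtractf)
    also have "\<dots> \<le> (\<Sum>i\<in>UNIV. d i * A i j)"
      using stochastic_nonneg[OF A] by (intro sum_mono mult_right_mono) (auto simp: d_def)
    finally show ?thesis
      using stochastic_nonneg[OF A] by (auto simp: d_def intro!: sum_nonneg)
  qed
  have "(\<Sum>j\<in>UNIV. \<Sum>i\<in>UNIV. d i * A i j) = (\<Sum>i\<in>UNIV. d i)"
    by (subst sum.swap) (simp add: row flip: sum_distrib_left)
  then have "(\<Sum>j\<in>UNIV. (\<Sum>i\<in>UNIV. d i * A i j) - d j) = 0"
    by (simp add: sum_subtractf)
  then have inv: "d j = (\<Sum>i\<in>UNIV. d i * A i j)" for j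
    using sum_nonneg_eq_0_iff[of UNIV "\<lambda>j. (\<Sum>i\<in>UNIV. d i * A i j) - d j"] sub by simp
  have pow: "d j = (\<Sum>i\<in>UNIV. d i * mtx_pow A n i j)" for n j
  proof (induction n)
    case 0
    show ?case by (simp add: if_distrib cong: if_cong)
  next
    case (Suc n)
    have "(\<Sum>i\<in>UNIV. d i * mtx_pow A (Suc n) i j) = (\<Sum>i\<in>UNIV. \<Sum>z\<in>UNIV. d i * A i z * mtx_pow A n z j)"
      by (simp add: mtx_mult_def sum_distrib_left mult.assoc)
    also have "\<dots> = (\<Sum>z\<in>UNIV. d z * mtx_pow A n z j)"
      by (subst sum.swap) (simp add: inv[symmetric] flip: sum_distrib_right)
    finally show ?case using Suc by simp
  qed
  have "d i = 0" for i
  proof (rule ccontr)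
    assume "d i \<noteq> 0"
    then have di: "0 < d i" unfolding d_def by linarith
    have "0 < d j" for j
    proof -
      obtain n where "0 < mtx_pow A n i j" using irr by (auto simp: irreducible_mtx_def)
      then have "0 < d i * mtx_pow A n i j" using di by simp
      also have "\<dots> \<le> (\<Sum>i\<in>UNIV. d i * mtx_pow A n i j)"
        using stochastic_nonneg[OF stochastic_mtx_pow[OF A]]
        by (intro member_le_sum[of i UNIV "\<lambda>i. d i * mtx_pow A n i j"]) (auto simp: d_def)
      finally show ?thesis using pow by simp
    qed
    then have "0 < p j - q j" for j by (simp add: d_def less_max_iff_disj)
    then have "0 < (\<Sum>j\<in>UNIV. p j - q j)" by (intro sum_pos) auto
    then show False using pq by (simp add: sum_subtractf)
  qed
  then have le: "0 \<le> q i - p i" for i unfolding d_def by (smt (verit))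
  have "(\<Sum>i\<in>UNIV. q i - p i) = 0" using pq by (simp add: sum_subtractf)
  then have "q i - p i = 0" for i
    using sum_nonneg_eq_0_iff[of UNIV "\<lambda>i. q i - p i"] le by simp
  then show ?thesis by (simp add: fun_eq_iff)
qed

section \<open>The phase process\<close>

lemma phase_function: "g (snd x) = (\<Sum>j\<in>UNIV. g j * upper 0 j x)"
  for x :: "nat \<times> 'd::finite"
  by (cases x) (simp add: upper_def if_distrib cong: if_cong)

lemma expect_phase:
  fixes g :: "'d::finite \<Rightarrow> ennreal"
  shows "expect \<mu> (\<lambda>x. g (snd x)) = (\<Sum>j\<in>UNIV. g j * expect \<mu> (upper 0 j))"
  unfolding phase_function expect_sum expect_cmult ..

lemma op_dom_meas_dom:
  assumes "stochastic Q" "stochastic T" "op_dom Q T"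
  shows "meas_dom (\<lambda>y. ennreal (Q x y)) (\<lambda>y. ennreal (T x y))"
  using assms(3) stochastic_app_one[OF assms(1), of x] stochastic_app_one[OF assms(2), of x]
  unfolding meas_dom_def op_dom_def app_def by (simp del: split_paired_All)

lemma op_mono_meas_dom:
  assumes "stochastic T" "op_mono T"
  shows "meas_dom (\<lambda>y. ennreal (T (k, i) y)) (\<lambda>y. ennreal (T (Suc k, i) y))"
  using assms(2) stochastic_app_one[OF assms(1), of "(k, i)"] stochastic_app_one[OF assms(1), of "(Suc k, i)"]
  unfolding meas_dom_def op_mono_def binc_def app_def by (simp del: split_paired_All)

text \<open>\<open>upper 0 j\<close> depends on the phase alone, so \<open>meas_dom_phase\<close>
  turns both the domination by \<open>Pt\<close> and the monotonicity of \<open>Pt\<close> in the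
  level into equalities.\<close>

lemma phase_mtx_app:
  fixes Pt :: "(nat \<times> 'd::finite) mtx"
  assumes Q: "stochastic Q" and T: "stochastic Pt" and d: "op_dom Q Pt" "op_mono Pt"
  shows "app Q (upper 0 j) (k, i) = ennreal (phase_mtx Pt k0 i j)"
proof -
  have u: "(upper 0 j :: nat \<times> 'd \<Rightarrow> ennreal) = (\<lambda>x. if snd x = j then 1 else 0)" for j
    by (auto simp: upper_def)
  have "app Q (upper 0 j) (k, i) = app Pt (upper 0 j) (k, i)"
    unfolding app_def u using op_dom_meas_dom[OF Q T d(1), of "(k, i)"]
    by (rule meas_dom_phase[where g="\<lambda>i. if i = j then 1 else 0"]) simp
  moreover have "app Pt (upper 0 j) (l, i) = app Pt (upper 0 j) (0, i)" for l
  proof (induction l)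
    case (Suc l)
    have "app Pt (upper 0 j) (l, i) = app Pt (upper 0 j) (Suc l, i)"
      unfolding app_def u using op_mono_meas_dom[OF T d(2), of l i]
      by (rule meas_dom_phase[where g="\<lambda>i. if i = j then 1 else 0"]) simp
    then show ?case using Suc by simp
  qed simp
  ultimately show ?thesis
    using app_upper[OF T, of 0 j k0 i] by (metis phase_mtx_def)
qed

lemma op_dom_refl: "op_dom T T"
  by (simp add: op_dom_def)

lemma op_dom_trans: "op_dom Q P \<Longrightarrow> op_dom P T \<Longrightarrow> op_dom Q T"
  unfolding op_dom_def by (meson order_trans)

lemma app_phase:
  fixes Pt :: "(nat \<times> 'd::finite) mtx" and g :: "'d \<Rightarrow> ennreal"
  assumes "stochastic Q" "stochastic Pt" "op_dom Q Pt" "op_mono Pt"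
  shows "app Q (\<lambda>x. g (snd x)) x = app (phase_mtx Pt k0) g (snd x)"
proof (cases x)
  case (Pair k i)
  have "app Q (\<lambda>x. g (snd x)) x = (\<Sum>j\<in>UNIV. g j * app Q (upper 0 j) (k, i))"
    unfolding app_def expect_phase Pair ..
  also have "\<dots> = app (phase_mtx Pt k0) g i"
    unfolding phase_mtx_app[OF assms, of _ k i k0]
    by (simp add: app_def expect_def nn_integral_count_space_finite mult.commute)
  finally show ?thesis by (simp add: Pair)
qed

lemma stochastic_phase_mtx:
  fixes Pt :: "(nat \<times> 'd::finite) mtx"
  assumes "stochastic Pt" "op_mono Pt"
  shows "stochastic (phase_mtx Pt k0)"
proof (rule stochasticI)
  show "0 \<le> phase_mtx Pt k0 i j" for i j
    unfolding phase_mtx_def block_tail_def using stochastic_nonneg[OF assms(1)] by (intro infsum_nonneg)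
  show "app (phase_mtx Pt k0) (\<lambda>x. 1) i = 1" for i
    using app_phase[OF assms(1) assms(1) op_dom_refl assms(2), of "\<lambda>_. 1" "(0, i)" k0]
    by (simp add: stochastic_app_one assms)
qed

text \<open>A path between states of level 0 projects to a path of phases, so \<open>n\<close>-step
  probabilities can only grow under the projection.\<close>

lemma irreducible_phase_mtx:
  fixes Pt :: "(nat \<times> 'd::finite) mtx"
  assumes T: "stochastic Pt" and m: "op_mono Pt" and irr: "irreducible_mtx Pt"
  shows "irreducible_mtx (phase_mtx Pt k0)"
  unfolding irreducible_mtx_def
proof (intro allI)
  fix i j :: 'd
  let ?A = "phase_mtx Pt k0"
  have A: "stochastic ?A" by (rule stochastic_phase_mtx[OF T m])
  obtain n where n: "0 < mtx_pow Pt n (0, i) (0, j)" using irr unfolding irreducible_mtx_def by blast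
  have pow: "(app Pt ^^ k) (\<lambda>x. g (snd x)) = (\<lambda>x. (app ?A ^^ k) g (snd x))" for g k
  proof (induction k)
    case (Suc k)
    have "(app Pt ^^ Suc k) (\<lambda>x. g (snd x)) = app Pt (\<lambda>x. (app ?A ^^ k) g (snd x))"
      by (simp add: Suc)
    also have "\<dots> = (\<lambda>x. app ?A ((app ?A ^^ k) g) (snd x))"
      using app_phase[OF T T op_dom_refl m] by (rule ext)
    finally show ?case by simp
  qed simp
  have "ennreal (mtx_pow Pt n (0, i) (0, j)) = app (mtx_pow Pt n) (\<lambda>x. if x = (0, j) then 1 else 0) (0, i)"
    by (rule app_delta[symmetric])
  also have "\<dots> \<le> app (mtx_pow Pt n) (\<lambda>x. (\<lambda>k. if k = j then 1 else 0) (snd x)) (0, i)"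
    by (rule app_mono) auto
  also have "\<dots> = app (mtx_pow ?A n) (\<lambda>k. if k = j then 1 else 0) i"
    unfolding app_mtx_pow[OF T] app_mtx_pow[OF A]
    using fun_cong[OF pow[of n "\<lambda>k. if k = j then 1 else 0"], of "(0, i)"] by simp
  also have "\<dots> = ennreal (mtx_pow ?A n i j)" by (rule app_delta)
  finally have "ennreal (mtx_pow Pt n (0, i) (0, j)) \<le> ennreal (mtx_pow ?A n i j)" .
  moreover have "0 < ennreal (mtx_pow Pt n (0, i) (0, j))" using n by simp
  ultimately have "0 < ennreal (mtx_pow ?A n i j)" by (rule order.strict_trans2[rotated])
  then show "\<exists>n. 0 < mtx_pow ?A n i j" by (auto simp: ennreal_less_zero_iff)
qed

lemma stationary_prob: "stationary P \<mu> \<Longrightarrow> prob_vec \<mu>"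
  by (simp add: stationary_def)

text \<open>The phase marginal of \<open>\<mu>\<close> is invariant under \<open>phase_mtx\<close>,
  whose stationary vector is unique. This serves both \<open>P\<close> and its truncations, which
  therefore share their phase marginal.\<close>

lemma stationary_phase:
  fixes Pt :: "(nat \<times> 'd::finite) mtx"
  assumes Q: "stochastic Q" and T: "stochastic Pt" and d: "op_dom Q Pt" and m: "op_mono Pt"
    and irr: "irreducible_mtx Pt" and \<omega>: "stationary (phase_mtx Pt k0) \<omega>" and \<mu>: "stationary Q \<mu>"
  shows "expect (\<lambda>x. ennreal (\<mu> x)) (upper 0 i) = ennreal (\<omega> i)"
proof -
  let ?A = "phase_mtx Pt k0" and ?E = "\<lambda>j. expect (\<lambda>x. ennreal (\<mu> x)) (upper 0 j)"
  have A: "stochastic ?A" by (rule stochastic_phase_mtx[OF T m])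
  have tot: "expect (\<lambda>x. ennreal (\<mu> x)) (\<lambda>x. 1) = 1" by (rule prob_vec_total[OF stationary_prob[OF \<mu>]])
  have sumE: "(\<Sum>j\<in>UNIV. ?E j) = 1"
    using expect_phase[of "\<lambda>x. ennreal (\<mu> x)" "\<lambda>_. 1"] tot by simp
  define p where "p j = enn2real (?E j)" for j
  have "?E j \<le> 1" for j
    using expect_mono[of "upper 0 j" "\<lambda>x. 1" "\<lambda>x. ennreal (\<mu> x)"] by (simp add: tot upper_le_one)
  then have E: "?E j = ennreal (p j)" for j
    unfolding p_def by (metis ennreal_enn2real ennreal_one_less_top order_le_less_trans)
  have p0: "0 \<le> p j" for j by (simp add: p_def)
  have pe: "ennreal (p j) = ennreal (\<Sum>i\<in>UNIV. p i * ?A i j)" for j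
  proof -
    have "?E j = expect (\<lambda>x. ennreal (\<mu> x)) (app Q (upper 0 j))"
      by (rule expect_stationary[OF Q \<mu>, symmetric])
    also have "app Q (upper 0 j) = (\<lambda>x. ennreal (?A (snd x) j))"
      using phase_mtx_app[OF Q T d m, of j _ _ k0] by (auto simp: fun_eq_iff)
    also have "expect (\<lambda>x. ennreal (\<mu> x)) \<dots> = (\<Sum>i\<in>UNIV. ennreal (?A i j) * ?E i)"
      by (rule expect_phase)
    also have "\<dots> = ennreal (\<Sum>i\<in>UNIV. p i * ?A i j)"
      unfolding E using p0 stochastic_nonneg[OF A]
      by (subst sum_ennreal[symmetric]) (auto simp: ennreal_mult mult.commute)
    finally show ?thesis by (simp add: E)
  qed
  have p: "p j = (\<Sum>i\<in>UNIV. p i * ?A i j)" for j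
  proof -
    have "0 \<le> (\<Sum>i\<in>UNIV. p i * ?A i j)"
      by (intro sum_nonneg mult_nonneg_nonneg p0 stochastic_nonneg[OF A])
    then show ?thesis using pe[of j] p0[of j] by (simp only: ennreal_inj)
  qed
  have \<omega>1: "(\<Sum>i\<in>UNIV. \<omega> i) = 1" and \<omega>A: "\<omega> j = (\<Sum>i\<in>UNIV. \<omega> i * ?A i j)" for j
    using \<omega> has_sum_finite_UNIV[of \<omega> 1] has_sum_finite_UNIV[of "\<lambda>i. \<omega> i * ?A i j" "\<omega> j" for j]
    by (simp_all add: stationary_def prob_vec_def)
  have "(\<Sum>j\<in>UNIV. p j) = 1"
    using sumE p0 by (simp add: E sum_ennreal sum_nonneg)
  then have "p = \<omega>"
    using finite_stationary_unique[OF A irreducible_phase_mtx[OF T m irr] p \<omega>A] \<omega>1 by simp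
  then show ?thesis using E by simp
qed

text \<open>Testing on the indicator of \<open>A\<close>, where \<open>\<mu>\<close> exceeds
  \<open>\<eta>\<close>, suffices: both masses are 1, so the excess on \<open>A\<close> equals the
  deficit off \<open>A\<close>, whence the factor 2.\<close>

lemma l1_dist_le:
  assumes \<mu>: "prob_vec \<mu>" and \<eta>: "prob_vec \<eta>" and "0 \<le> \<epsilon>"
    and le: "\<And>f. (\<And>x. f x \<le> 1) \<Longrightarrow>
      expect (\<lambda>x. ennreal (\<mu> x)) f \<le> expect (\<lambda>x. ennreal (\<eta> x)) f + ennreal \<epsilon>"
  shows "l1_dist \<mu> \<eta> \<le> 2 * \<epsilon>"
proof -
  define A where "A = {x. \<eta> x < \<mu> x}"
  define ind where "ind x = (if x \<in> A then 1 else 0 :: real)" for x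
  have nn: "0 \<le> \<mu> x" "0 \<le> \<eta> x" for x using \<mu> \<eta> by (auto simp: prob_vec_def)
  have hs: "(\<mu> has_sum 1) UNIV" "(\<eta> has_sum 1) UNIV" using \<mu> \<eta> by (auto simp: prob_vec_def)
  have s: "(\<lambda>x. \<mu> x * ind x) summable_on UNIV" "(\<lambda>x. \<eta> x * ind x) summable_on UNIV"
    using hs[THEN has_sum_imp_summable] nn
    by (auto intro: summable_on_comparison_test simp: ind_def)
  have E: "expect (\<lambda>x. ennreal (\<kappa> x)) (\<lambda>x. if x \<in> A then 1 else 0) = ennreal (\<Sum>\<^sub>\<infinity>x. \<kappa> x * ind x)"
    if "\<And>x. 0 \<le> \<kappa> x" "(\<lambda>x. \<kappa> x * ind x) summable_on UNIV" for \<kappa>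
    unfolding expect_def using infsum_nn_integral[OF _ that(2)] that(1)
    by (auto simp: ind_def intro!: nn_integral_cong)
  have "ennreal (\<Sum>\<^sub>\<infinity>x. \<mu> x * ind x) \<le> ennreal (\<Sum>\<^sub>\<infinity>x. \<eta> x * ind x) + ennreal \<epsilon>"
    using le[of "\<lambda>x. if x \<in> A then 1 else 0"] E[OF nn(1) s(1)] E[OF nn(2) s(2)] by simp
  then have *: "(\<Sum>\<^sub>\<infinity>x. \<mu> x * ind x) \<le> (\<Sum>\<^sub>\<infinity>x. \<eta> x * ind x) + \<epsilon>"
    using \<open>0 \<le> \<epsilon>\<close> nn by (simp add: infsum_nonneg ind_def flip: ennreal_plus)
  have "((\<lambda>x. 2 * (\<mu> x * ind x) + (- 2) * (\<eta> x * ind x) + (\<eta> x + (- 1) * \<mu> x))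
      has_sum (2 * (\<Sum>\<^sub>\<infinity>x. \<mu> x * ind x) + (- 2) * (\<Sum>\<^sub>\<infinity>x. \<eta> x * ind x) + (1 + (- 1) * 1))) UNIV"
    by (intro has_sum_add has_sum_cmult_right hs has_sum_infsum s)
  moreover have "(\<lambda>x. 2 * (\<mu> x * ind x) + (- 2) * (\<eta> x * ind x) + (\<eta> x + (- 1) * \<mu> x)) = (\<lambda>x. \<bar>\<mu> x - \<eta> x\<bar>)"
    by (auto simp: fun_eq_iff ind_def A_def)
  ultimately have "l1_dist \<mu> \<eta> = 2 * ((\<Sum>\<^sub>\<infinity>x. \<mu> x * ind x) - (\<Sum>\<^sub>\<infinity>x. \<eta> x * ind x))"
    unfolding l1_dist_def using infsumI by fastforce
  then show ?thesis using * by simp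
qed

section \<open>Truncation as capping of the level\<close>

definition cap :: "nat \<Rightarrow> nat \<times> 'd \<Rightarrow> nat \<times> 'd" where
  "cap n x = (min (fst x) n, snd x)"

text \<open>Block column \<open>n\<close> of the truncation collects the mass of all levels from
  \<open>n\<close> on, so a truncated step is a step of \<open>P\<close> followed by
  \<open>cap n\<close>.\<close>

lemma app_lc_trunc:
  fixes P :: "(nat \<times> 'd::finite) mtx"
  assumes P: "stochastic P"
  shows "app (lc_trunc P n) f x = app P (\<lambda>y. f (cap n y)) x"
proof (cases x)
  case (Pair k i)
  let ?Q = "\<lambda>l j. ennreal (lc_trunc P n (k, i) (l, j))" and ?P = "\<lambda>l j. ennreal (P (k, i) (l, j))"
  have tail: "ennreal (\<Sum>\<^sub>\<infinity>m\<in>{n..}. P (k, i) (m, j)) = (\<integral>\<^sup>+l. (if n \<le> l then ?P l j else 0) \<partial>count_space UNIV)" for j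
    using app_upper[OF P, of n j k i] by (simp add: app_def expect_upper block_tail_def)
  have "(\<integral>\<^sup>+l. ?Q l j * f (l, j) \<partial>count_space UNIV) = (\<integral>\<^sup>+l. ?P l j * f (cap n (l, j)) \<partial>count_space UNIV)" for j
  proof -
    let ?lo = "\<integral>\<^sup>+l. (if l < n then ?P l j * f (l, j) else 0) \<partial>count_space UNIV"
    have "(\<integral>\<^sup>+l. ?Q l j * f (l, j) \<partial>count_space UNIV)
        = (\<integral>\<^sup>+l. (if l < n then ?P l j * f (l, j) else 0)
            + ennreal (\<Sum>\<^sub>\<infinity>m\<in>{n..}. P (k, i) (m, j)) * f (n, j) * (if l = n then 1 else 0) \<partial>count_space UNIV)"
      by (rule nn_integral_cong) (auto simp: lc_trunc_def)
    also have "\<dots> = ?lo + ennreal (\<Sum>\<^sub>\<infinity>m\<in>{n..}. P (k, i) (m, j)) * f (n, j)"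
      by (simp add: nn_integral_add nn_integral_delta del: mult_if_delta)
    also have "ennreal (\<Sum>\<^sub>\<infinity>m\<in>{n..}. P (k, i) (m, j)) * f (n, j)
        = (\<integral>\<^sup>+l. (if n \<le> l then ?P l j * f (n, j) else 0) \<partial>count_space UNIV)"
      unfolding tail by (subst nn_integral_multc[symmetric]) (auto intro!: nn_integral_cong)
    also have "?lo + \<dots> = (\<integral>\<^sup>+l. ?P l j * f (cap n (l, j)) \<partial>count_space UNIV)"
      by (subst nn_integral_add[symmetric]) (auto simp: cap_def min_def intro!: nn_integral_cong)
    finally show ?thesis .
  qed
  then show ?thesis unfolding Pair app_def expect_def nn_integral_levels by simp
qed

lemma stochastic_lc_trunc:
  fixes P :: "(nat \<times> 'd::finite) mtx"
  assumes P: "stochastic P"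
  shows "stochastic (lc_trunc P n)"
proof (rule stochasticI)
  show "0 \<le> lc_trunc P n x y" for x y
    using stochastic_nonneg[OF P] by (auto simp: lc_trunc_def infsum_nonneg split: prod.split)
  show "app (lc_trunc P n) (\<lambda>x. 1) x = 1" for x
    using app_lc_trunc[OF P, of n "\<lambda>_. 1"] stochastic_app_one[OF P] by simp
qed

lemma lc_trunc_op_dom:
  fixes P :: "(nat \<times> 'd::finite) mtx"
  assumes P: "stochastic P"
  shows "op_dom (lc_trunc P n) P"
  unfolding op_dom_def
proof (intro allI impI)
  fix f :: "nat \<times> 'd \<Rightarrow> ennreal" and x :: "nat \<times> 'd" assume f: "binc f"
  show "app (lc_trunc P n) f x \<le> app P f x"
    unfolding app_lc_trunc[OF P]
  proof (rule app_mono)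
    fix y :: "nat \<times> 'd"
    show "f (cap n y) \<le> f y"
      using binc_le[OF f, of "min (fst y) n" "fst y" "snd y"] by (simp add: cap_def)
  qed
qed

section \<open>The error bound\<close>

lemma app_pow_le_one:
  assumes "stochastic P" "\<And>x. g x \<le> 1" shows "(app P ^^ k) g x \<le> 1"
proof (induction k arbitrary: x)
  case (Suc k)
  show ?case by (simp add: app_le_one[OF assms(1)] Suc)
qed (simp add: assms(2))

context
  fixes P :: "(nat \<times> 'd::finite) mtx" and n :: nat and \<mu> :: "nat \<times> 'd \<Rightarrow> real"
  assumes P: "stochastic P" and \<mu>: "stationary (lc_trunc P n) \<mu>"
begin

lemma trunc_invariant: "expect (\<lambda>x. ennreal (\<mu> x)) (app P (\<lambda>y. f (cap n y))) = expect (\<lambda>x. ennreal (\<mu> x)) f"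
  using expect_stationary[OF stochastic_lc_trunc[OF P] \<mu>, of f]
  by (simp add: app_lc_trunc[OF P, abs_def])

text \<open>Capping can raise \<open>g\<close> only above level \<open>n\<close>, and by at most 1.
  Whether the level reaches \<open>n\<close> is unaffected by capping, so invariance evaluates the
  cost as the stationary mass of that set.\<close>

lemma trunc_step:
  assumes g: "\<And>x. g x \<le> 1"
  shows "expect (\<lambda>x. ennreal (\<mu> x)) g
    \<le> expect (\<lambda>x. ennreal (\<mu> x)) (app P g) + (\<Sum>j\<in>UNIV. expect (\<lambda>x. ennreal (\<mu> x)) (upper n j))"
proof -
  let ?E = "expect (\<lambda>x. ennreal (\<mu> x))"
  have "(\<lambda>y. upper n j (cap n y)) = upper n j" for j :: 'd
    by (auto simp: cap_def upper_def fun_eq_iff)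
  then have up: "?E (app P (upper n j)) = ?E (upper n j)" for j
    using trunc_invariant[of "upper n j"] by simp
  have "g (cap n y) \<le> g y + (\<Sum>j\<in>UNIV. upper n j y)" for y
  proof (cases "n \<le> fst y")
    case True
    have "g (cap n y) \<le> upper n (snd y) y" using True g by (cases y) (simp add: upper_def)
    also have "\<dots> \<le> (\<Sum>j\<in>UNIV. upper n j y)" by (rule member_le_sum) auto
    also have "\<dots> \<le> g y + (\<Sum>j\<in>UNIV. upper n j y)" by simp
    finally show ?thesis .
  qed (auto simp: cap_def min_def)
  then have "app P (\<lambda>y. g (cap n y)) x \<le> app P g x + (\<Sum>j\<in>UNIV. app P (upper n j) x)" for x
    using app_mono[of "\<lambda>y. g (cap n y)" "\<lambda>y. g y + (\<Sum>j\<in>UNIV. upper n j y)" P x]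
    by (simp add: app_add app_sum)
  then have "?E g \<le> ?E (\<lambda>x. app P g x + (\<Sum>j\<in>UNIV. app P (upper n j) x))"
    unfolding trunc_invariant[of g, symmetric] by (intro expect_mono)
  also have "\<dots> = ?E (app P g) + (\<Sum>j\<in>UNIV. ?E (app P (upper n j)))"
    by (simp add: expect_add expect_sum)
  finally show ?thesis by (simp add: up)
qed

lemma trunc_iterate:
  assumes g: "\<And>x. g x \<le> 1"
  shows "expect (\<lambda>x. ennreal (\<mu> x)) g \<le> expect (\<lambda>x. ennreal (\<mu> x)) ((app P ^^ k) g)
    + of_nat k * (\<Sum>j\<in>UNIV. expect (\<lambda>x. ennreal (\<mu> x)) (upper n j))"
proof (induction k)
  case (Suc k)
  let ?E = "expect (\<lambda>x. ennreal (\<mu> x))" and ?\<delta> = "\<Sum>j\<in>UNIV. expect (\<lambda>x. ennreal (\<mu> x)) (upper n j)"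
  have "?E ((app P ^^ k) g) \<le> ?E ((app P ^^ Suc k) g) + ?\<delta>"
    using trunc_step[of "(app P ^^ k) g", OF app_pow_le_one[OF P g]] by simp
  then have "?E g \<le> ?E ((app P ^^ Suc k) g) + ?\<delta> + of_nat k * ?\<delta>"
    using Suc by (meson add_right_mono order_trans)
  then show ?case by (simp add: distrib_right add_ac)
qed simp

text \<open>The truncated chain lives on finitely many levels, so \<open>v\<close> is integrable and the drift
  inequality may be integrated against \<open>\<mu>\<close>.\<close>

lemma trunc_tail:
  fixes Pt :: "(nat \<times> 'd::finite) mtx"
  assumes Pt: "stochastic Pt" "op_mono Pt" "op_dom P Pt" and b: "0 \<le> b"
    and v: "block_increasing v" "\<And>x. 1 \<le> v x"
    and \<phi>: "\<And>t. 1 \<le> t \<Longrightarrow> 0 < \<phi> t" "mono_on {1..} \<phi>"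
    and drift: "\<And>x. app (mtx_pow Pt M) (\<lambda>y. ennreal (v y)) x + ennreal (\<phi> (v x)) \<le> ennreal (v x) + ennreal b"
  shows "expect (\<lambda>x. ennreal (\<mu> x)) (upper n j) \<le> ennreal (b / \<phi> (v (n, j)))"
proof -
  let ?E = "expect (\<lambda>x. ennreal (\<mu> x))" and ?v = "\<lambda>x. ennreal (v x)"
  have Q: "stochastic (lc_trunc P n)" by (rule stochastic_lc_trunc[OF P])
  have tot: "?E (\<lambda>x. k) = k" for k
    using expect_cmult[of "\<lambda>x. ennreal (\<mu> x)" k "\<lambda>x. 1"] prob_vec_total[OF stationary_prob[OF \<mu>]] by simp
  have mono: "v (k, i) \<le> v (l, i)" if "k \<le> l" for k l i
    using lift_Suc_mono_le[of "\<lambda>k. v (k, i)"] v(1) that by (simp add: block_increasing_def)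
  have bv: "binc ?v" by (auto simp: binc_def intro!: ennreal_leI mono)
  have fin: "?E ?v < top"
  proof -
    \<comment> \<open>\<open>v\<close> grows with the level, so its values at level
      \<open>n\<close>, summed over the phases, bound it on all capped states.\<close>
    define C where "C = (\<Sum>i\<in>UNIV. v (n, i))"
    have "v (cap n y) \<le> C" for y
    proof -
      have "v (cap n y) \<le> v (n, snd y)" unfolding cap_def by (rule mono) simp
      also have "\<dots> \<le> C"
        unfolding C_def using v(2) by (intro member_le_sum) (auto intro: order_trans[of 0 1])
      finally show ?thesis .
    qed
    then have "app P (\<lambda>y. ?v (cap n y)) x \<le> app P (\<lambda>y. ennreal C) x" for x
      by (intro app_mono ennreal_leI)
    then have "?E ?v \<le> ?E (\<lambda>x. ennreal C)"
      unfolding trunc_invariant[of ?v, symmetric] by (intro expect_mono) (simp add: app_const[OF P])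
    then show ?thesis by (auto simp: tot intro: le_less_trans)
  qed
  \<comment> \<open>The truncation is dominated by \<open>Pt\<close>, so \<open>M\<close> stationary
    steps give \<open>?E ?v \<le> ?E (app (mtx_pow Pt M) ?v)\<close>. Combined with the drift, the
    finite \<open>?E ?v\<close> cancels.\<close>
  have "op_dom (mtx_pow (lc_trunc P n) M) (mtx_pow Pt M)"
    by (rule op_dom_pow[OF Q Pt(1,2) op_dom_trans[OF lc_trunc_op_dom[OF P] Pt(3)]])
  then have "(app (lc_trunc P n) ^^ M) ?v x \<le> app (mtx_pow Pt M) ?v x" for x
    using bv unfolding op_dom_def app_mtx_pow[OF Q, symmetric] by blast
  then have "?E ?v \<le> ?E (app (mtx_pow Pt M) ?v)"
    unfolding expect_stationary_pow[OF Q \<mu>, of M ?v, symmetric] by (rule expect_mono)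
  then have "?E (\<lambda>x. ennreal (\<phi> (v x))) + ?E ?v
      \<le> ?E (\<lambda>x. app (mtx_pow Pt M) ?v x + ennreal (\<phi> (v x)))"
    unfolding expect_add by (simp add: add.commute add_right_mono)
  also have "\<dots> \<le> ?E (\<lambda>x. ?v x + ennreal b)" by (rule expect_mono) (rule drift)
  also have "\<dots> = ennreal b + ?E ?v" by (simp add: expect_add tot add.commute)
  finally have \<phi>b: "?E (\<lambda>x. ennreal (\<phi> (v x))) \<le> ennreal b"
    using fin by (rule ennreal_add_right_cancel_le)
  \<comment> \<open>Markov's inequality for \<open>\<phi>\<close> of \<open>v\<close>, which is
    nondecreasing in the level.\<close>
  have "ennreal (\<phi> (v (n, j))) * ?E (upper n j) = ?E (\<lambda>x. ennreal (\<phi> (v (n, j))) * upper n j x)"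
    by (rule expect_cmult[symmetric])
  also have "\<dots> \<le> ?E (\<lambda>x. ennreal (\<phi> (v x)))"
  proof (rule expect_mono)
    fix x :: "nat \<times> 'd"
    obtain k i where x: "x = (k, i)" by force
    have "\<phi> (v (n, i)) \<le> \<phi> (v (k, i))" if "n \<le> k"
      using \<phi>(2) v(2)[of "(n, i)"] v(2)[of "(k, i)"] mono[OF that, of i] by (auto simp: mono_on_def)
    then show "ennreal (\<phi> (v (n, j))) * upper n j x \<le> ennreal (\<phi> (v x))"
      by (auto simp: x upper_def intro: ennreal_leI)
  qed
  also note \<phi>b
  finally have le: "ennreal (\<phi> (v (n, j))) * ?E (upper n j) \<le> ennreal b" .
  have "?E (upper n j) \<le> 1"
    using expect_mono[of "upper n j" "\<lambda>x. 1" "\<lambda>x. ennreal (\<mu> x)"] tot[of 1] by (simp add: upper_le_one)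
  then obtain a where a: "0 \<le> a" "?E (upper n j) = ennreal a"
    by (cases "?E (upper n j)") (auto simp: top_unique)
  have p: "0 < \<phi> (v (n, j))" using \<phi>(1) v(2) by simp
  then have "\<phi> (v (n, j)) * a \<le> b" using le a b by (simp add: a flip: ennreal_mult)
  then show ?thesis unfolding a(2) using p by (intro ennreal_leI) (simp add: field_simps)
qed

end

text \<open>The phase distribution placed on level 0 is the least measure with that phase marginal,
  hence a common lower comparison point for all the stationary vectors.\<close>

definition level0_vec :: "('d \<Rightarrow> real) \<Rightarrow> nat \<times> 'd \<Rightarrow> ennreal" where
  "level0_vec \<omega> x = (if fst x = 0 then ennreal (\<omega> (snd x)) else 0)"

lemma meas_dom_level0_vec:
  fixes \<mu> :: "nat \<times> 'd::finite \<Rightarrow> ennreal"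
  assumes tot: "expect \<mu> (\<lambda>x. 1) = 1" and ph: "\<And>i. expect \<mu> (upper 0 i) = ennreal (\<omega> i)"
  shows "meas_dom (level0_vec \<omega>) \<mu>"
proof -
  have E: "expect (level0_vec \<omega>) f = expect \<mu> (\<lambda>x. f (0, snd x))" for f
  proof -
    have "expect (level0_vec \<omega>) f = expect f (on0 (\<lambda>x. ennreal (\<omega> (snd x))))"
      unfolding expect_def by (intro nn_integral_cong) (simp add: level0_vec_def on0_def mult.commute)
    also have "\<dots> = expect \<mu> (\<lambda>x. f (0, snd x))"
      unfolding expect_phase[of \<mu> "\<lambda>i. f (0, i)"] ph by (simp add: expect_on0)
    finally show ?thesis .
  qed
  show ?thesis
    unfolding meas_dom_def
  proof (intro conjI allI impI)
    fix f :: "nat \<times> 'd \<Rightarrow> ennreal" assume "binc f \<and> (\<forall>x. f x \<le> 1)"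
    then show "expect (level0_vec \<omega>) f \<le> expect \<mu> f"
      unfolding E using binc_le[of f 0] by (intro expect_mono) (metis le0 prod.collapse)
  qed (simp_all add: E tot)
qed

text \<open>\<open>\<mu>\<close> and \<open>\<pi>\<close> need not be comparable, but
  \<open>level0_vec \<omega>\<close> lies below both. Two couplings, one under \<open>\<mu>\<close>
  and one under \<open>\<pi>\<close>, cost \<open>C\<close> each; replacing truncated steps by
  \<open>M * m\<close> steps of \<open>P\<close> costs the rest, and \<open>l1_dist_le\<close>
  doubles the total. The rate comes from the drift of \<open>w\<close>, the tail from that of
  \<open>v\<close>.\<close>

lemma (in concave_rate) truncation_bound:
  fixes M :: nat and P Pt :: "(nat \<times> 'd::finite) mtx" and w v :: "nat \<times> 'd \<Rightarrow> real"
  defines "T \<equiv> mtx_pow Pt M"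
  assumes P: "stochastic P" and Pt: "stochastic Pt" "op_mono Pt" "op_dom P Pt" "irreducible_mtx Pt"
    and \<pi>: "stationary P \<pi>" and \<omega>: "stationary (phase_mtx Pt k0) \<omega>"
    and \<mu>: "stationary (lc_trunc P n) \<mu>"
    and c: "0 < c" and w: "\<And>x. 1 \<le> w x"
    and drift_w: "\<And>x. 0 < fst x \<Longrightarrow> app T (\<lambda>y. ennreal (w y)) x \<le> ennreal (w x - c * \<phi> (w x))"
    and b: "0 \<le> b" and v: "block_increasing v" "\<And>x. 1 \<le> v x"
    and drift_v: "\<And>x. app T (\<lambda>y. ennreal (v y)) x + ennreal (\<phi> (v x)) \<le> ennreal (v x) + ennreal b"
  shows "l1_dist \<mu> \<pi> \<le> 4 * (level_avg w 1 \<omega> / rate c (Suc m))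
    + 2 * (real M * real m * (\<Sum>j\<in>UNIV. b / \<phi> (v (n, j))))"
proof -
  define C where "C = level_avg w 1 \<omega> / rate c (Suc m)"
  define D where "D = (\<Sum>j\<in>UNIV. b / \<phi> (v (n, j)))"
  define R where "R = mtx_pow P M"
  have T: "stochastic T" "op_mono T" unfolding T_def using Pt by (simp_all add: stochastic_mtx_pow op_mono_pow)
  have R: "stochastic R" "op_dom R T"
    unfolding R_def T_def using P Pt by (simp_all add: stochastic_mtx_pow op_dom_pow)
  have Rm: "(app R ^^ m) f = (app P ^^ (M * m)) f" for f
  proof -
    have "app R = app P ^^ M" by (rule ext) (simp add: R_def app_mtx_pow P)
    then show ?thesis by (simp add: funpow_mult)
  qed
  have \<omega>0: "0 \<le> \<omega> i" for i using \<omega> by (simp add: stationary_def prob_vec_def)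
  have C: "0 \<le> C"
    unfolding C_def level_avg_def using \<omega>0 w rate_pos[OF c, of "Suc m"]
    by (intro divide_nonneg_pos sum_nonneg mult_nonneg_nonneg) (auto intro: order_trans[of 0 1])
  have D: "0 \<le> D" unfolding D_def using b pos v(2) by (intro sum_nonneg divide_nonneg_pos) auto
  have any: "meas_dom (level0_vec \<omega>) (\<lambda>x. ennreal (\<eta> x))"
      "meas_dom (\<lambda>x. ennreal (\<eta> x)) (\<lambda>x. ennreal (\<eta> x))"
      "expect (\<lambda>x. ennreal (\<eta> x)) (avoid T m) \<le> ennreal C"
    if Q: "stochastic Q" "op_dom Q Pt" and \<eta>: "stationary Q \<eta>" for Q \<eta>
  proof -
    have tot: "expect (\<lambda>x. ennreal (\<eta> x)) (\<lambda>x. 1) = 1" by (rule prob_vec_total[OF stationary_prob[OF \<eta>]])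
    have ph: "expect (\<lambda>x. ennreal (\<eta> x)) (upper 0 i) = ennreal (\<omega> i)" for i
      by (rule stationary_phase[OF Q(1) Pt(1) Q(2) Pt(2,4) \<omega> \<eta>])
    show "meas_dom (level0_vec \<omega>) (\<lambda>x. ennreal (\<eta> x))" by (rule meas_dom_level0_vec[OF tot ph])
    show "meas_dom (\<lambda>x. ennreal (\<eta> x)) (\<lambda>x. ennreal (\<eta> x))" by (simp add: meas_dom_def tot)
    have "op_dom (mtx_pow Q M) T" unfolding T_def by (rule op_dom_pow[OF Q(1) Pt(1,2) Q(2)])
    then have sub: "expect (\<lambda>x. ennreal (\<eta> x)) f \<le> expect (\<lambda>x. ennreal (\<eta> x)) (app T f)" if "binc f" for f
      unfolding expect_stationary_pow[OF Q(1) \<eta>, of M f, symmetric] using that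
      by (intro expect_mono) (simp add: op_dom_def app_mtx_pow[OF Q(1)] del: split_paired_All)
    have "ennreal (\<eta> (0, i)) \<le> ennreal (\<omega> i)" for i
      using expect_mono[of "\<lambda>x. if x = (0, i) then 1 else 0" "upper 0 i" "\<lambda>x. ennreal (\<eta> x)"]
      by (simp add: expect_delta ph) (simp add: upper_def)
    then show "expect (\<lambda>x. ennreal (\<eta> x)) (avoid T m) \<le> ennreal C"
      unfolding C_def by (intro stationary_avoid[OF T c w drift_w tot sub _ \<omega>0])
  qed
  note \<pi>s = any[OF P Pt(3) \<pi>]
  note \<mu>s = any[OF stochastic_lc_trunc[OF P] op_dom_trans[OF lc_trunc_op_dom[OF P] Pt(3)] \<mu>]
  have "l1_dist \<mu> \<pi> \<le> 2 * (C + C + real (M * m) * D)"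
  proof (rule l1_dist_le[OF stationary_prob[OF \<mu>] stationary_prob[OF \<pi>]])
    show "0 \<le> C + C + real (M * m) * D" using C D by simp
    fix f :: "nat \<times> 'd \<Rightarrow> ennreal" assume f: "\<And>x. f x \<le> 1"
    let ?E = "expect (\<lambda>x. ennreal (\<mu> x))" and ?F = "expect (\<lambda>x. ennreal (\<pi> x))"
    let ?X = "?E ((app R ^^ m) f)" and ?Y = "expect (level0_vec \<omega>) ((app R ^^ m) f)"
    have 1: "?E f \<le> ?X + of_nat (M * m) * (\<Sum>j\<in>UNIV. ?E (upper n j))"
      unfolding Rm by (rule trunc_iterate[OF P \<mu> f])
    have "(\<Sum>j\<in>UNIV. ?E (upper n j)) \<le> (\<Sum>j\<in>UNIV. ennreal (b / \<phi> (v (n, j))))"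
      using trunc_tail[OF P \<mu> Pt(1-3) b v pos mono drift_v[unfolded T_def]] by (intro sum_mono)
    also have "\<dots> = ennreal D"
      unfolding D_def using b pos v(2) by (intro sum_ennreal divide_nonneg_pos) auto
    finally have 2: "(\<Sum>j\<in>UNIV. ?E (upper n j)) \<le> ennreal D" .
    have 3: "?X \<le> ?Y + ennreal C"
      by (rule order_trans[OF coupling[OF R(1) T(1) R(2) T(2) \<mu>s(2) \<mu>s(1) f] add_left_mono[OF \<mu>s(3)]])
    have "?Y \<le> ?F ((app R ^^ m) f) + ennreal C"
      by (rule order_trans[OF coupling[OF R(1) T(1) R(2) T(2) \<pi>s(1) \<pi>s(2) f] add_left_mono[OF \<pi>s(3)]])
    also have "?F ((app R ^^ m) f) = ?F f"
      unfolding Rm by (rule expect_stationary_pow[OF P \<pi>])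
    finally have 4: "?Y \<le> ?F f + ennreal C" .
    have sums: "ennreal (C + C + real (M * m) * D) = ennreal C + ennreal C + ennreal (real (M * m)) * ennreal D"
      using C D by (simp only: ennreal_plus ennreal_mult add_nonneg_nonneg mult_nonneg_nonneg of_nat_0_le_iff)
    have "?E f \<le> ?X + of_nat (M * m) * ennreal D"
      by (rule order_trans[OF 1]) (intro add_left_mono mult_left_mono 2, simp)
    also have "\<dots> \<le> ?Y + ennreal C + of_nat (M * m) * ennreal D"
      by (rule add_right_mono[OF 3])
    also have "\<dots> \<le> ?F f + ennreal C + ennreal C + of_nat (M * m) * ennreal D"
      by (intro add_right_mono 4)
    also have "\<dots> = ?F f + ennreal (C + C + real (M * m) * D)"
      unfolding sums by (simp only: ennreal_of_nat_eq_real_of_nat add.assoc)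
    finally show "?E f \<le> ?F f + ennreal (C + C + real (M * m) * D)" .
  qed
  then show ?thesis by (simp add: C_def D_def)
qed

text \<open>Rates increase with the index, so passing from \<open>Suc m\<close> to
  \<open>m - 1\<close> and from 4 to 8 enlarges the bound to the claimed shape;
  \<open>1 \<le> m\<close> makes natural and real subtraction agree.\<close>

lemma (in concave_rate) rate_bound:
  assumes "0 \<le> L" "0 < c" "1 \<le> m"
  shows "4 * (L / rate c (Suc m)) \<le> 8 * inverse c / r_fn \<phi> (c * (real m - 1)) * L"
proof -
  have "L / rate c (Suc m) \<le> L / rate c (m - 1)"
    using assms rate_pos[OF assms(2)] rate_mono[OF assms(2), of "m - 1" "Suc m"]
    by (intro divide_left_mono) auto
  moreover have "0 \<le> L / rate c (m - 1)"
    using assms rate_pos[OF assms(2), of "m - 1"] by simp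
  ultimately have "4 * (L / rate c (Suc m)) \<le> 8 * (L / rate c (m - 1))" by linarith
  also have "\<dots> = 8 * inverse c / r_fn \<phi> (c * (real m - 1)) * L"
    using assms(3) by (simp add: rate_def of_nat_diff divide_simps)
  finally show ?thesis .
qed

text \<open>The summability in \<open>mtx_vec_le\<close> makes \<open>infsum\<close> the true value
  of the row. Nonnegativity of \<open>u\<close> is recorded because \<open>ennreal\<close> would
  clip a negative bound.\<close>

lemma mtx_vec_le_app:
  fixes T :: "'s::countable mtx"
  assumes T: "stochastic T" and v: "\<And>x. 0 \<le> v x" and le: "mtx_vec_le T v u"
  shows "app T (\<lambda>y. ennreal (v y)) x \<le> ennreal (u x)" and "0 \<le> u x"
proof -
  have s: "(\<lambda>y. T x y * v y) summable_on UNIV" and u: "(\<Sum>\<^sub>\<infinity>y. T x y * v y) \<le> u x"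
    using le by (auto simp: mtx_vec_le_def)
  have nn: "0 \<le> T x y * v y" for y using stochastic_nonneg[OF T] v by simp
  have "app T (\<lambda>y. ennreal (v y)) x = ennreal (\<Sum>\<^sub>\<infinity>y. T x y * v y)"
    unfolding app_def expect_def infsum_nn_integral[OF nn s]
    using stochastic_nonneg[OF T] v by (simp add: ennreal_mult)
  then show "app T (\<lambda>y. ennreal (v y)) x \<le> ennreal (u x)" using u by (simp add: ennreal_leI)
  show "0 \<le> u x" using u infsum_nonneg[of UNIV "\<lambda>y. T x y * v y"] nn by simp
qed

lemma app_above0:
  fixes T :: "(nat \<times> 'd::finite) mtx"
  assumes T: "stochastic T"
  shows "app T above0 x = ennreal (1 - (\<Sum>j\<in>UNIV. T x (0, j)))" and "(\<Sum>j\<in>UNIV. T x (0, j)) \<le> 1"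
proof -
  let ?z = "\<Sum>j\<in>UNIV. T x (0, j)"
  have z0: "0 \<le> ?z" using stochastic_nonneg[OF T] by (intro sum_nonneg)
  have "above0 y + (\<Sum>j\<in>UNIV. if y = (0, j) then 1 else 0) = 1" for y :: "nat \<times> 'd"
    by (cases y) (simp add: above0_def)
  then have "1 = app T (\<lambda>y. above0 y + (\<Sum>j\<in>UNIV. if y = (0, j) then 1 else 0)) x"
    using stochastic_app_one[OF T, of x] by simp
  also have "\<dots> = app T above0 x + ennreal ?z"
    unfolding app_add app_sum app_delta
    using stochastic_nonneg[OF T] by (simp add: sum_ennreal)
  finally have eq: "app T above0 x + ennreal ?z = 1" by simp
  have "app T above0 x \<le> 1" by (rule app_le_one[OF T]) (simp add: above0_def)
  then obtain a where a: "0 \<le> a" "app T above0 x = ennreal a"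
    by (cases "app T above0 x") (auto simp: top_unique)
  have "ennreal (a + ?z) = ennreal 1" using eq a z0 by (simp add: ennreal_plus)
  then have "a + ?z = 1" using a z0 by (simp only: ennreal_inj add_nonneg_nonneg zero_le_one)
  then show "app T above0 x = ennreal (1 - ?z)" "?z \<le> 1" using a by (simp_all add: eq_diff_eq[symmetric])
qed

theorem theorem4p1:
  fixes P Pt :: "(nat \<times> 'd::finite) mtx"
    and \<pi> :: "nat \<times> 'd \<Rightarrow> real"
    and \<omega> :: "'d \<Rightarrow> real"
    and v :: "nat \<times> 'd \<Rightarrow> real"
    and \<phi> :: "real \<Rightarrow> real"
    and b :: real
    and M K k0 :: nat
  assumes "stochastic P" and "irreducible_mtx P" and "positive_recurrent P"
    and "stationary P \<pi>"
    and "irreducible_mtx Pt" and "block_monotone Pt" and "block_dominated P Pt"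
    and "stationary (phase_mtx Pt k0) \<omega>"
    and "0 < b"
    and "block_increasing v" and "\<forall>x. 1 \<le> v x"
    and "\<forall>t\<ge>1. 0 < \<phi> t" and "mono_on {1..} \<phi>" and "\<phi> differentiable_on {1..}"
    and "concave_on {1..} \<phi>" and "(deriv \<phi> \<longlongrightarrow> 0) at_top"
    and "1 \<le> M"
    and drift: "mtx_vec_le (mtx_pow Pt M) v (\<lambda>x. v x - \<phi> (v x) + b * one_upto K x)"
  shows
    "((\<forall>i. 0 < (\<Sum>j\<in>UNIV. mtx_pow Pt M (K, i) (0, j))) \<longrightarrow>
       (\<forall>B::real. 0 < B \<and> (\<forall>i. b \<le> B * (\<Sum>j\<in>UNIV. mtx_pow Pt M (K, i) (0, j))) \<longrightarrow>
         (\<forall>(m::nat) (n::nat) \<pi>n. 1 \<le> m \<and> 1 \<le> n \<and> stationary (lc_trunc P n) \<pi>n \<longrightarrow>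
            l1_dist \<pi>n \<pi> \<le>
              8 * inverse (c_fn \<phi> B 1) / r_fn \<phi> (c_fn \<phi> B (real m - 1)) * (level_avg v 1 \<omega> + B)
              + 2 * real m * real M * b * (\<Sum>i\<in>UNIV. 1 / \<phi> (v (n, i))))))
     \<and> (K = 0 \<longrightarrow>
         (\<forall>(m::nat) (n::nat) \<pi>n. 1 \<le> m \<and> 1 \<le> n \<and> stationary (lc_trunc P n) \<pi>n \<longrightarrow>
            l1_dist \<pi>n \<pi> \<le>
              8 / r_fn \<phi> (real m - 1) * level_avg v 1 \<omega>
              + 2 * real m * real M * b * (\<Sum>i\<in>UNIV. 1 / \<phi> (v (n, i)))))"
proof -
  interpret concave_rate \<phi>
    using assms(12-15) by unfold_locales (auto intro: differentiable_imp_continuous_on)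
  let ?T = "mtx_pow Pt M"
  have Pt: "stochastic Pt" "op_mono Pt" "op_dom P Pt"
    using assms(1,6,7) block_dominated_op_dom
    by (auto simp: block_monotone_def intro: block_monotone_op_mono)
  have T: "stochastic ?T" "op_mono ?T" using Pt by (simp_all add: stochastic_mtx_pow op_mono_pow)
  have v: "1 \<le> v x" "0 \<le> v x" for x
    using assms(11)[rule_format, of x] by linarith+
  have \<phi>v: "0 < \<phi> (v x)" for x using pos v by simp
  define u where "u x = v x - \<phi> (v x) + b * one_upto K x" for x
  have Tv: "app ?T (\<lambda>y. ennreal (v y)) x \<le> ennreal (u x)" and u0: "0 \<le> u x" for x
    using mtx_vec_le_app[OF T(1) v(2) drift] by (auto simp: u_def)
  have one: "one_upto K x \<le> 1" for x :: "nat \<times> 'd" by (cases x) (simp add: one_upto_def)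
  have drift_v: "app ?T (\<lambda>y. ennreal (v y)) x + ennreal (\<phi> (v x)) \<le> ennreal (v x) + ennreal b" for x
  proof -
    have "app ?T (\<lambda>y. ennreal (v y)) x + ennreal (\<phi> (v x)) \<le> ennreal (u x) + ennreal (\<phi> (v x))"
      by (rule add_right_mono[OF Tv])
    also have "\<dots> = ennreal (u x + \<phi> (v x))" using u0 \<phi>v[of x] by (simp add: less_imp_le)
    also have "\<dots> \<le> ennreal (v x + b)"
      using mult_left_mono[OF one[of x], of b] assms(9) by (intro ennreal_leI) (simp add: u_def)
    also have "\<dots> = ennreal (v x) + ennreal b" using v assms(9) by simp
    finally show ?thesis .
  qed
  have \<omega>: "0 \<le> \<omega> i" "(\<Sum>i\<in>UNIV. \<omega> i) = 1" for i
    using assms(8) by (simp_all add: stationary_def prob_vec_def has_sum_finite_UNIV)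
  \<comment> \<open>Both claims are this estimate, with \<open>c\<close> and \<open>w\<close> chosen
    according to the case.\<close>
  have bound: "l1_dist \<pi>n \<pi> \<le> 8 * inverse c / r_fn \<phi> (c * (real m - 1)) * level_avg w 1 \<omega>
      + 2 * real m * real M * b * (\<Sum>i\<in>UNIV. 1 / \<phi> (v (n, i)))"
    if c: "0 < c" and w: "\<And>x. 1 \<le> w x" and m: "1 \<le> m" and \<pi>n: "stationary (lc_trunc P n) \<pi>n"
      and drift_w: "\<And>x. 0 < fst x \<Longrightarrow> app ?T (\<lambda>y. ennreal (w y)) x \<le> ennreal (w x - c * \<phi> (w x))"
    for c w m n \<pi>n
  proof -
    have "0 \<le> level_avg w 1 \<omega>"
      unfolding level_avg_def using \<omega> w by (intro sum_nonneg mult_nonneg_nonneg) (auto intro: order_trans[of 0 1])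
    from rate_bound[OF this c m]
      truncation_bound[OF assms(1) Pt assms(5,4,8) \<pi>n c w drift_w _ assms(10) v(1) drift_v, of m] assms(9)
    have "l1_dist \<pi>n \<pi> \<le> 8 * inverse c / r_fn \<phi> (c * (real m - 1)) * level_avg w 1 \<omega>
        + 2 * (real M * real m * (\<Sum>j\<in>UNIV. b / \<phi> (v (n, j))))" by linarith
    also have "(\<Sum>j\<in>UNIV. b / \<phi> (v (n, j))) = b * (\<Sum>j\<in>UNIV. 1 / \<phi> (v (n, j)))"
      by (simp add: sum_distrib_left)
    finally show ?thesis by (simp add: mult_ac)
  qed
  show ?thesis
  proof (intro conjI impI allI; elim conjE)
    fix B :: real and m n :: nat and \<pi>n
    assume B: "0 < B" "\<forall>i. b \<le> B * (\<Sum>j\<in>UNIV. ?T (K, i) (0, j))"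
      and m: "1 \<le> m" and \<pi>n: "stationary (lc_trunc P n) \<pi>n"
    define c where "c = \<phi> 1 / \<phi> (B + 1)"
    have c: "0 < c" using pos[of 1] pos[of "B + 1"] B by (simp add: c_def)
    \<comment> \<open>Adding \<open>B\<close> off level 0 gains \<open>B\<close> times the
      probability of jumping to level 0, which pays for \<open>b * one_upto K\<close>.\<close>
    define w where "w x = v x + (if fst x = 0 then 0 else B)" for x :: "nat \<times> 'd"
    have w: "1 \<le> w x" for x using v(1)[of x] B by (simp add: w_def)
    have wB: "ennreal (w y) = ennreal (v y) + ennreal B * above0 y" for y
      using v B by (simp add: w_def above0_def)
    have drift_w: "app ?T (\<lambda>y. ennreal (w y)) x \<le> ennreal (w x - c * \<phi> (w x))" if x: "0 < fst x" for x
    proof -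
      obtain k i where ki: "x = (k, i)" by force
      let ?z = "\<lambda>x. \<Sum>j\<in>UNIV. ?T x (0, j)"
      note z = app_above0[OF T(1)]
      \<comment> \<open>The probability of jumping to level 0 decreases in the starting level, so
        the assumption at level \<open>K\<close> covers all levels below it.\<close>
      have "b * one_upto K x \<le> B * ?z x"
      proof (cases "k \<le> K")
        case True
        have "binc (app ?T above0)" using T(2) binc_above0 unfolding op_mono_def by blast
        then have "app ?T above0 (k, i) \<le> app ?T above0 (K, i)" using True by (rule binc_le)
        then have "?z (K, i) \<le> ?z (k, i)" using z(2)[of "(K, i)"] unfolding z(1) by simp
        then have "B * ?z (K, i) \<le> B * ?z (k, i)" using B by simp
        moreover have "b \<le> B * ?z (K, i)" using B by blast
        ultimately show ?thesis using True by (simp add: ki one_upto_def)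
      next
        case False
        then show ?thesis using B stochastic_nonneg[OF T(1)]
          by (simp add: ki one_upto_def sum_nonneg)
      qed
      moreover have "c * \<phi> (v x + B) \<le> \<phi> (v x)" using rate_fn_shift[OF v(1) B(1)] by (simp add: c_def)
      ultimately have le: "u x + B * (1 - ?z x) \<le> w x - c * \<phi> (w x)"
        using x by (simp add: u_def w_def right_diff_distrib)
      have "app ?T (\<lambda>y. ennreal (w y)) x \<le> ennreal (u x) + ennreal B * ennreal (1 - ?z x)"
        unfolding wB app_add app_cmult z(1) by (rule add_right_mono[OF Tv])
      also have "\<dots> = ennreal (u x + B * (1 - ?z x))"
        using u0 B z(2)[of x] by (simp add: ennreal_mult ennreal_plus)
      finally show ?thesis using le by (meson ennreal_leI order_trans)
    qed
    \<comment> \<open>\<open>\<omega>\<close> sums to 1 and level 1 is off level 0, so the average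
      of the added \<open>B\<close> is \<open>B\<close>.\<close>
    have "level_avg w 1 \<omega> = level_avg v 1 \<omega> + B"
      by (simp add: level_avg_def w_def distrib_left sum.distrib \<omega> flip: sum_distrib_right)
    then show "l1_dist \<pi>n \<pi> \<le> 8 * inverse (c_fn \<phi> B 1) / r_fn \<phi> (c_fn \<phi> B (real m - 1)) * (level_avg v 1 \<omega> + B)
        + 2 * real m * real M * b * (\<Sum>i\<in>UNIV. 1 / \<phi> (v (n, i)))"
      using bound[OF c w m \<pi>n drift_w] by (simp add: c_fn_def c_def)
  next
    fix m n :: nat and \<pi>n
    assume K: "K = 0" and m: "1 \<le> m" and \<pi>n: "stationary (lc_trunc P n) \<pi>n"
    \<comment> \<open>For \<open>K = 0\<close> the term with \<open>b\<close> lives on level 0 only,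
      so \<open>v\<close> itself serves as \<open>w\<close>, with \<open>c = 1\<close>.\<close>
    have "app ?T (\<lambda>y. ennreal (v y)) x \<le> ennreal (v x - 1 * \<phi> (v x))" if "0 < fst x" for x
      using Tv[of x] that K by (cases x) (simp add: u_def one_upto_def)
    from bound[OF zero_less_one v(1) m \<pi>n this]
    show "l1_dist \<pi>n \<pi> \<le> 8 / r_fn \<phi> (real m - 1) * level_avg v 1 \<omega>
        + 2 * real m * real M * b * (\<Sum>i\<in>UNIV. 1 / \<phi> (v (n, i)))"
      by simp
  qed
qed

end
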